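(* Let $E=E(\mathbf{n},\mathbf{c})$ be a uniform Cantor set with associated data $\Lambda$, $\{m_k\}_{k\in\Lambda}$, $\{s_k\}_{k\in\Lambda}$. Let $\mu$ be a Borel probability measure on $E$ with $\mu(I_w)>0$ for all $w\in W$, and let $\{p_w\}_{w\in W}$ be the corresponding sequence, with $P_w=(p_{w1},\dots,p_{wn_k})$ for $w\in W_{k-1}$. Then $\mu$ is doubling on $E$ if and only if there is a constant $C>1$ such that $P_w$ is $C$-uniform for all $w\in W$ and, for each $k\in\Lambda$, the following conditions hold: (a) for all $w\in W_{k-1}$, $1\le i<n_k$ and $1\le t<m_k$, the vector $(P_{wiu_{t-1}},P_{w(i+1)1^{t-1}})$ is $C$-uniform and $$C^{-1}\prod_{j=1}^{t}p_{wiu_j}\leq\prod_{j=1}^{t}p_{w(i+1)1^j}\leq C\prod_{j=1}^{t}p_{wiu_j};$$ (b) for all $w\in W_{k-1}$ and $1\le i<n_k$, the vector $(P_{wiu_{m_k-1}},P_{w(i+1)1^{m_k-1}})$ is $(C,s_k)$-uniform.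
   Context: Uniform Cantor set: let $\mathbf{n}=\{n_k\}_{k\ge1}$ be integers with $n_k\geq 2$ and $\mathbf{c}=\{c_k\}_{k\ge1}$ real numbers in $(0,1)$ with $(n_k-1)c_k<1$ for all $k$. Put $E_0=[0,1]$; $E_k$ is obtained from $E_{k-1}$ by deleting from every component $I$ of $E_{k-1}$ exactly $n_k-1$ open intervals, each of length $c_k|I|$, such that the remaining $n_k$ closed intervals are of equal length. Then $E(\mathbf{n},\mathbf{c})=\bigcap_{k\ge 0}E_k$, with the metric inherited from $\mathbb{R}$. Components of $E_k$ are called components of level $k$, and components of $E_{k-1}\setminus E_k$ gaps of level $k$. The length of a component of level $k$ is $\delta_k=\prod_{i=1}^k\frac{1-(n_i-1)c_i}{n_i}$ (with $\delta_0=1$) and the length of a gap of level $k$ is $\varepsilon_k=c_k\delta_{k-1}$. Words: $W_k=\{i_1\cdots i_k:1\le i_j\le n_j\}$ for $k\ge1$, $W=\bigcup_{k\ge1}W_k$, $W_0=\{\text{empty word}\}$, and $I_{\text{empty}}=[0,1]$. Inductively, for $w\in W_{k-1}$, $I_{w1},\dots,I_{wn_k}$ denote from left to right the $n_k$ components of level $k$ contained in $I_w$ (for $k=1$, $wi=i$). For $w\in W_{k-1}$, $1\le i\le n_k$ and $t\ge0$, $wiu_t=wi\,n_{k+1}\cdots n_{k+t}$ denotes the maximal (lexicographically) word in $W_{k+t}$ with prefix $wi$, and $wi1^t=wi\,1\cdots1$ denotes the minimal word in $W_{k+t}$ with prefix $wi$; for $t=0$ both equal $wi$. For a Borel probability measure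 $\mu$ on $E$ with $\mu(I_w)>0$ for all $w\in W$ (where $\mu(I)$ means $\mu(I\cap E)$), the corresponding sequence $\{p_w\}_{w\in W}$ is defined by $p_{wi}=\mu(I_{wi})/\mu(I_w)$ for $k\ge1$, $w\in W_{k-1}$, $1\le i\le n_k$, and $P_w=(p_{w1},p_{w2},\dots,p_{wn_k})$ for $w\in W_{k-1}$. Data: $\Lambda=\{k\ge1:\varepsilon_k<\delta_k\}$. For $k\in\Lambda$, $m_k$ is the unique positive integer with $\delta_{k+m_k}\le\varepsilon_k<\delta_{k+m_k-1}$, and $s_k$ is the unique positive integer with $s_k\delta_{k+m_k}+(s_k-1)\varepsilon_{k+m_k}\le\varepsilon_k<(s_k+1)\delta_{k+m_k}+s_k\varepsilon_{k+m_k}$. Vectors: for $C\ge1$ and an integer $1\le s\le q$, a vector $P=(p_1,\dots,p_q)$ with positive entries is $(C,s)$-uniform if $$C^{-1}\le\frac{p_{i+1}+\cdots+p_{i+l}}{p_{j+1}+\cdots+p_{j+l}}\le C$$ for all integers $i,j,l$ with $s\le l\le q$ and $0\le i\le j\le i+l\le j+l\le q$. It is $C$-uniform if it is $(C,1)$-uniform. For two vectors $P,Q$, $(P,Q)$ denotes their concatenation. A Borel regular measure $\mu$ on a metric space $X$ is doubling if there is a constant $C\ge1$ with $0<\mu(B(x,2r))\le C\mu(B(x,r))<\infty$ for all $x\in X$ and $r>0$. *)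

theory Defs
  imports "HOL-Probability.Probability"
begin

text \<open>
  Sequences are functions on \<open>nat\<close> used at indices \<open>k \<ge> 1\<close>; their values at \<open>0\<close> are irrelevant.
\<close>

definition cantor_params :: "(nat \<Rightarrow> nat) \<Rightarrow> (nat \<Rightarrow> real) \<Rightarrow> bool" where
  "cantor_params n c \<longleftrightarrow>
     (\<forall>k\<ge>1. 2 \<le> n k \<and> 0 < c k \<and> c k < 1 \<and> (real (n k) - 1) * c k < 1)"

text \<open>
  The \<open>n - 1\<close> open intervals of length \<open>c (b - a)\<close> whose removal from \<open>[a, b]\<close> leaves
  \<open>n\<close> closed intervals of equal length \<open>d\<close>: from \<open>n d + (n - 1) c (b - a) = b - a\<close> one gets
  the value of \<open>d\<close>, and the \<open>j\<close>-th gap is preceded by \<open>j\<close> of these intervals and \<open>j - 1\<close> gaps.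
\<close>

definition deleted_gaps :: "nat \<Rightarrow> real \<Rightarrow> real \<Rightarrow> real \<Rightarrow> real set set" where
  "deleted_gaps n c a b =
     (let g = c * (b - a); d = (1 - (real n - 1) * c) / real n * (b - a)
      in (\<lambda>j. {a + real j * d + (real j - 1) * g <..< a + real j * d + real j * g}) ` {1..<n})"

fun cantor_level :: "(nat \<Rightarrow> nat) \<Rightarrow> (nat \<Rightarrow> real) \<Rightarrow> nat \<Rightarrow> real set" where
  "cantor_level n c 0 = {0..1}"
| "cantor_level n c (Suc k) =
     cantor_level n c k -
       (\<Union>J\<in>components (cantor_level n c k).
          \<Union>(deleted_gaps (n (Suc k)) (c (Suc k)) (Inf J) (Sup J)))"

definition cantor_set :: "(nat \<Rightarrow> nat) \<Rightarrow> (nat \<Rightarrow> real) \<Rightarrow> real set" where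
  "cantor_set n c = (\<Inter>k. cantor_level n c k)"

definition comp_length :: "(nat \<Rightarrow> nat) \<Rightarrow> (nat \<Rightarrow> real) \<Rightarrow> nat \<Rightarrow> real" where
  "comp_length n c k = (\<Prod>i=1..k. (1 - (real (n i) - 1) * c i) / real (n i))"

definition gap_length :: "(nat \<Rightarrow> nat) \<Rightarrow> (nat \<Rightarrow> real) \<Rightarrow> nat \<Rightarrow> real" where
  "gap_length n c k = c k * comp_length n c (k - 1)"

text \<open>A word \<open>i\<^sub>1 \<dots> i\<^sub>k\<close> is the list \<open>w\<close> with \<open>w ! j = i\<^bsub>j+1\<^esub>\<close>.\<close>

definition words :: "(nat \<Rightarrow> nat) \<Rightarrow> nat \<Rightarrow> nat list set" where
  "words n k = {w. length w = k \<and> (\<forall>j<k. 1 \<le> w ! j \<and> w ! j \<le> n (Suc j))}"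

definition all_words :: "(nat \<Rightarrow> nat) \<Rightarrow> nat list set" where
  "all_words n = (\<Union>k\<in>{1..}. words n k)"

text \<open>
  The interval \<open>I\<^sub>w\<close>, by its left endpoint and length.  That these are exactly the components
  of the respective levels, indexed from left to right inside \<open>I\<^sub>w\<close>, is proved below
  (\<open>components_cantor_level\<close>, \<open>components_in_word_interval\<close>, \<open>word_interval_left_to_right\<close>).
\<close>

definition word_left :: "(nat \<Rightarrow> nat) \<Rightarrow> (nat \<Rightarrow> real) \<Rightarrow> nat list \<Rightarrow> real" where
  "word_left n c w =
     (\<Sum>j<length w. (real (w ! j) - 1) * (comp_length n c (Suc j) + gap_length n c (Suc j)))"

definition word_interval :: "(nat \<Rightarrow> nat) \<Rightarrow> (nat \<Rightarrow> real) \<Rightarrow> nat list \<Rightarrow> real set" where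
  "word_interval n c w = {word_left n c w .. word_left n c w + comp_length n c (length w)}"

definition max_word_ext :: "(nat \<Rightarrow> nat) \<Rightarrow> nat list \<Rightarrow> nat \<Rightarrow> nat list" where
  "max_word_ext n v t = v @ map n [length v + 1..<length v + t + 1]"

definition min_word_ext :: "nat list \<Rightarrow> nat \<Rightarrow> nat list" where
  "min_word_ext v t = v @ replicate t 1"

definition word_mass :: "(nat \<Rightarrow> nat) \<Rightarrow> (nat \<Rightarrow> real) \<Rightarrow> real measure \<Rightarrow> nat list \<Rightarrow> real" where
  "word_mass n c \<mu> w = measure \<mu> (word_interval n c w \<inter> cantor_set n c)"

text \<open>\<open>p\<^sub>v\<close> for a nonempty word \<open>v = w i\<close>, so that \<open>butlast v = w\<close>.\<close>

definition word_ratio :: "(nat \<Rightarrow> nat) \<Rightarrow> (nat \<Rightarrow> real) \<Rightarrow> real measure \<Rightarrow> nat list \<Rightarrow> real" where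
  "word_ratio n c \<mu> v = word_mass n c \<mu> v / word_mass n c \<mu> (butlast v)"

definition ratio_vec :: "(nat \<Rightarrow> nat) \<Rightarrow> (nat \<Rightarrow> real) \<Rightarrow> real measure \<Rightarrow> nat list \<Rightarrow> real list" where
  "ratio_vec n c \<mu> w = map (\<lambda>i. word_ratio n c \<mu> (w @ [i])) [1..<n (Suc (length w)) + 1]"

definition large_gap_levels :: "(nat \<Rightarrow> nat) \<Rightarrow> (nat \<Rightarrow> real) \<Rightarrow> nat set" where
  "large_gap_levels n c = {k. 1 \<le> k \<and> gap_length n c k < comp_length n c k}"

definition depth_idx :: "(nat \<Rightarrow> nat) \<Rightarrow> (nat \<Rightarrow> real) \<Rightarrow> nat \<Rightarrow> nat" where
  "depth_idx n c k =
     (THE m. 1 \<le> m \<and> comp_length n c (k + m) \<le> gap_length n c k \<and>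
        gap_length n c k < comp_length n c (k + m - 1))"

definition block_idx :: "(nat \<Rightarrow> nat) \<Rightarrow> (nat \<Rightarrow> real) \<Rightarrow> nat \<Rightarrow> nat" where
  "block_idx n c k =
     (let d = comp_length n c (k + depth_idx n c k); g = gap_length n c (k + depth_idx n c k)
      in THE s. 1 \<le> s \<and> real s * d + (real s - 1) * g \<le> gap_length n c k \<and>
           gap_length n c k < (real s + 1) * d + real s * g)"

text \<open>
  With zero-based lists, \<open>p\<^bsub>i+1\<^esub> + \<dots> + p\<^bsub>i+l\<^esub>\<close> is the sum of \<open>P ! m\<close> over \<open>i \<le> m < i + l\<close>.
  The constraints under which the notion is introduced are part of the predicate.
\<close>

definition uniform_from :: "real \<Rightarrow> nat \<Rightarrow> real list \<Rightarrow> bool" where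
  "uniform_from C s P \<longleftrightarrow>
     1 \<le> C \<and> 1 \<le> s \<and> s \<le> length P \<and> (\<forall>x\<in>set P. 0 < x) \<and>
     (\<forall>i j l. s \<le> l \<and> l \<le> length P \<and> i \<le> j \<and> j \<le> i + l \<and> j + l \<le> length P \<longrightarrow>
        inverse C \<le> (\<Sum>m=i..<i+l. P ! m) / (\<Sum>m=j..<j+l. P ! m) \<and>
        (\<Sum>m=i..<i+l. P ! m) / (\<Sum>m=j..<j+l. P ! m) \<le> C)"

abbreviation uniform_vec :: "real \<Rightarrow> real list \<Rightarrow> bool" where
  "uniform_vec C P \<equiv> uniform_from C 1 P"

definition borel_measure_on :: "'a::topological_space set \<Rightarrow> 'a measure \<Rightarrow> bool" where
  "borel_measure_on X \<mu> \<longleftrightarrow> sets \<mu> = sets (restrict_space borel X)"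

text \<open>
  \<open>X\<close> carries the induced metric, so its balls are the sets \<open>ball x r \<inter> X\<close>.  A measure on the
  Borel sets of \<open>X\<close> has a Borel regular outer measure by construction.
\<close>

definition doubling_measure_on :: "'a::metric_space set \<Rightarrow> 'a measure \<Rightarrow> bool" where
  "doubling_measure_on X \<mu> \<longleftrightarrow>
     borel_measure_on X \<mu> \<and>
     (\<exists>C\<ge>1. \<forall>x\<in>X. \<forall>r>0.
        0 < emeasure \<mu> (ball x (2 * r) \<inter> X) \<and>
        emeasure \<mu> (ball x (2 * r) \<inter> X) \<le> ennreal C * emeasure \<mu> (ball x r \<inter> X) \<and>
        ennreal C * emeasure \<mu> (ball x r \<inter> X) < \<infinity>)"

subsection \<open>The encodings agree with the construction\<close>

lemma components_finite_disjoint_Union: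
  fixes F :: "'a::topological_space set set"
  assumes fin: "finite F" and disj: "pairwise disjnt F"
    and F: "\<And>S. S \<in> F \<Longrightarrow> closed S \<and> connected S \<and> S \<noteq> {}"
  shows "components (\<Union>F) = F"
proof -
  have sub: "T \<subseteq> S" if T: "connected T" "T \<subseteq> \<Union>F" and S: "S \<in> F" and ne: "S \<inter> T \<noteq> {}" for S T
  proof -
    let ?R = "\<Union>(F - {S})"
    have "closed S" "closed ?R" using fin F S by (auto intro!: closed_Union)
    moreover have "S \<inter> ?R \<inter> T = {}"
      using disj S by (auto simp: pairwise_def disjnt_def)
    moreover have "T \<subseteq> S \<union> ?R" using T(2) by auto
    ultimately have "?R \<inter> T = {}"
      using T(1) ne unfolding connected_closed by blast
    then show ?thesis using \<open>T \<subseteq> S \<union> ?R\<close> by blast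
  qed
  have cc: "connected_component_set (\<Union>F) x = S" if "S \<in> F" "x \<in> S" for S x
  proof (rule connected_component_unique)
    show "connected S" using F that by blast
    show "c' \<subseteq> S" if "x \<in> c'" "c' \<subseteq> \<Union>F" "connected c'" for c'
      using sub[of c' S] that \<open>S \<in> F\<close> \<open>x \<in> S\<close> by blast
  qed (use that in auto)
  show ?thesis
  proof (intro equalityI subsetI)
    fix S assume "S \<in> components (\<Union>F)"
    then show "S \<in> F" using cc by (auto simp: components_def)
  next
    fix S assume S: "S \<in> F"
    then obtain x where "x \<in> S" using F by blast
    then show "S \<in> components (\<Union>F)" using cc[OF S] S by (metis UnionI componentsI)
  qed
qed

lemma interval_subdivision:
  fixes d g y :: real
  assumes "1 \<le> m" "0 \<le> y" "y \<le> real m * d + (real m - 1) * g"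
  shows "(\<exists>i\<in>{1..m}. (real i - 1) * (d + g) \<le> y \<and> y \<le> (real i - 1) * (d + g) + d) \<or>
         (\<exists>j\<in>{1..<m}. real j * d + (real j - 1) * g < y \<and> y < real j * d + real j * g)"
  using assms
proof (induction m rule: nat_induct_at_least)
  case base
  then show ?case by auto
next
  case (Suc m)
  consider "y \<le> real m * d + (real m - 1) * g"
    | "real m * d + (real m - 1) * g < y" "y < real m * d + real m * g"
    | "real m * d + real m * g \<le> y" by linarith
  then show ?case
  proof cases
    case 1
    then show ?thesis using Suc by force
  next
    case 2
    then show ?thesis using Suc by (intro disjI2 bexI[of _ m]) auto
  next
    case 3
    then show ?thesis using Suc by (intro disjI1 bexI[of _ "Suc m"]) (auto simp: algebra_simps)
  qed
qed

context
  fixes n :: "nat \<Rightarrow> nat" and c :: "nat \<Rightarrow> real"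
  assumes params: "cantor_params n c"
begin

private abbreviation (input) "d k \<equiv> comp_length n c k"
private abbreviation (input) "g k \<equiv> gap_length n c k"

lemma param_facts:
  assumes "1 \<le> k"
  shows "2 \<le> n k" "0 < c k" "c k < 1" "(real (n k) - 1) * c k < 1"
  using params assms unfolding cantor_params_def by blast+

lemma comp_length_0: "d 0 = 1"
  by (simp add: comp_length_def)

lemma comp_length_Suc:
  "d (Suc k) = (1 - (real (n (Suc k)) - 1) * c (Suc k)) / real (n (Suc k)) * d k"
  by (simp add: comp_length_def)

lemma comp_length_pos: "0 < d k"
proof (induction k)
  case (Suc k)
  have "0 < (1 - (real (n (Suc k)) - 1) * c (Suc k)) / real (n (Suc k))"
    using param_facts[of "Suc k"] by (intro divide_pos_pos) auto
  then show ?case unfolding comp_length_Suc using Suc.IH by (rule mult_pos_pos)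
qed (simp add: comp_length_0)

lemma gap_length_pos: "1 \<le> k \<Longrightarrow> 0 < g k"
  by (simp add: gap_length_def comp_length_pos param_facts)

lemma comp_length_split:
  "d k = real (n (Suc k)) * d (Suc k) + (real (n (Suc k)) - 1) * g (Suc k)"
proof -
  have "n (Suc k) > 0" using param_facts[of "Suc k"] by simp
  then show ?thesis by (simp add: comp_length_Suc gap_length_def field_simps)
qed

lemma comp_length_half: "2 * d (Suc k) \<le> d k"
proof -
  have n2: "2 \<le> real (n (Suc k))" using param_facts(1)[of "Suc k"] by simp
  have "2 * d (Suc k) \<le> real (n (Suc k)) * d (Suc k)"
    using n2 comp_length_pos[of "Suc k"] by (intro mult_right_mono) auto
  moreover have "0 \<le> (real (n (Suc k)) - 1) * g (Suc k)"
    using n2 gap_length_pos[of "Suc k"] by simp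
  ultimately show ?thesis using comp_length_split[of k] by linarith
qed

lemma word_left_snoc:
  "word_left n c (w @ [i]) =
     word_left n c w + (real i - 1) * (d (Suc (length w)) + g (Suc (length w)))"
  by (simp add: word_left_def nth_append)

lemma words_0: "words n 0 = {[]}"
  by (auto simp: words_def)

lemma words_Suc: "words n (Suc k) = (\<Union>w\<in>words n k. (\<lambda>i. w @ [i]) ` {1..n (Suc k)})"
proof (intro equalityI subsetI)
  fix v assume v: "v \<in> words n (Suc k)"
  then have "v \<noteq> []" by (auto simp: words_def)
  then have "v = butlast v @ [last v]" by simp
  moreover have "butlast v \<in> words n k" using v by (auto simp: words_def nth_butlast)
  moreover have "last v \<in> {1..n (Suc k)}"
  proof -
    have "last v = v ! k" using v \<open>v \<noteq> []\<close> by (simp add: words_def last_conv_nth)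
    then show ?thesis using v by (auto simp: words_def)
  qed
  ultimately show "v \<in> (\<Union>w\<in>words n k. (\<lambda>i. w @ [i]) ` {1..n (Suc k)})" by blast
qed (auto simp: words_def nth_append less_Suc_eq)

lemma finite_words: "finite (words n k)"
  by (induction k) (simp_all add: words_0 words_Suc)

lemma word_interval_left_to_right:
  assumes "length w = k" "i < j" "x \<in> word_interval n c (w @ [i])" "y \<in> word_interval n c (w @ [j])"
  shows "x < y"
proof -
  let ?D = "d (Suc k) + g (Suc k)"
  have "x \<le> word_left n c w + (real i - 1) * ?D + d (Suc k)"
    "word_left n c w + (real j - 1) * ?D \<le> y"
    using assms by (auto simp: word_interval_def word_left_snoc)
  moreover have "real i * ?D \<le> (real j - 1) * ?D"
    using assms(2) comp_length_pos[of "Suc k"] gap_length_pos[of "Suc k"]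
    by (intro mult_right_mono) auto
  moreover have "(real i - 1) * ?D + d (Suc k) < real i * ?D"
    using gap_length_pos[of "Suc k"] by (simp add: algebra_simps)
  ultimately show ?thesis by linarith
qed

lemma word_interval_children:
  assumes w: "w \<in> words n k"
  defines "G \<equiv> \<Union>(deleted_gaps (n (Suc k)) (c (Suc k))
                   (Inf (word_interval n c w)) (Sup (word_interval n c w)))"
  shows "G \<subseteq> word_interval n c w"
    and "word_interval n c w - G = (\<Union>i\<in>{1..n (Suc k)}. word_interval n c (w @ [i]))"
proof -
  let ?N = "n (Suc k)" and ?a = "word_left n c w"
  let ?d = "d (Suc k)" and ?g = "g (Suc k)"
  have len: "length w = k" using w by (simp add: words_def)
  have N: "2 \<le> ?N" using param_facts[of "Suc k"] by simp
  have dp: "0 < ?d" and gp: "0 < ?g"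
    using comp_length_pos gap_length_pos by auto
  have I: "word_interval n c w = {?a .. ?a + d k}"
    by (simp add: word_interval_def len)
  have IS: "Inf (word_interval n c w) = ?a" "Sup (word_interval n c w) = ?a + d k"
    using comp_length_pos[of k] by (simp_all add: I)
  have G: "G = (\<Union>j\<in>{1..<?N}. {?a + real j * ?d + (real j - 1) * ?g <..< ?a + real j * ?d + real j * ?g})"
    unfolding G_def IS deleted_gaps_def Let_def by (simp add: comp_length_Suc gap_length_def)
  have child: "word_interval n c (w @ [i]) =
      {?a + (real i - 1) * (?d + ?g) .. ?a + (real i - 1) * (?d + ?g) + ?d}" for i
    by (simp add: word_interval_def word_left_snoc len)
  have split: "d k = real ?N * ?d + (real ?N - 1) * ?g" by (rule comp_length_split)
  show sub: "G \<subseteq> word_interval n c w"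
  proof
    fix x assume "x \<in> G"
    then obtain j where j: "1 \<le> j" "j < ?N" "?a + real j * ?d + (real j - 1) * ?g < x"
      "x < ?a + real j * ?d + real j * ?g" by (auto simp: G)
    have "0 \<le> real j * ?d" "0 \<le> (real j - 1) * ?g" using j dp gp by simp_all
    moreover have "real j * ?d \<le> real ?N * ?d" "real j * ?g \<le> (real ?N - 1) * ?g"
      using j dp gp by (auto intro!: mult_right_mono)
    ultimately show "x \<in> word_interval n c w" using j split by (auto simp: I)
  qed
  have "x \<in> word_interval n c w - G" if "x \<in> word_interval n c (w @ [i])" "1 \<le> i" "i \<le> ?N" for x i
  proof -
    have x: "?a + (real i - 1) * (?d + ?g) \<le> x" "x \<le> ?a + (real i - 1) * (?d + ?g) + ?d"
      using that by (auto simp: child)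
    have "0 \<le> (real i - 1) * (?d + ?g)" using that dp gp by simp
    moreover have "(real i - 1) * (?d + ?g) \<le> (real ?N - 1) * (?d + ?g)"
      using that dp gp by (intro mult_right_mono) auto
    moreover have "(real ?N - 1) * (?d + ?g) + ?d = d k" by (simp add: split algebra_simps)
    ultimately have "x \<in> word_interval n c w" using x by (auto simp: I)
    moreover have "x \<notin> G"
    proof
      assume "x \<in> G"
      then obtain j where j: "1 \<le> j" "j < ?N" "?a + real j * ?d + (real j - 1) * ?g < x"
        "x < ?a + real j * ?d + real j * ?g" by (auto simp: G)
      show False
      proof (cases "j < i")
        case True
        then have "real j * (?d + ?g) \<le> (real i - 1) * (?d + ?g)"
          using dp gp by (intro mult_right_mono) auto
        then show False using j x by (simp add: algebra_simps)
      next
        case False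
        then have "(real i - 1) * (?d + ?g) \<le> (real j - 1) * (?d + ?g)"
          using dp gp by (intro mult_right_mono) auto
        then show False using j x by (simp add: algebra_simps)
      qed
    qed
    ultimately show ?thesis by blast
  qed
  moreover have "\<exists>i\<in>{1..?N}. x \<in> word_interval n c (w @ [i])"
    if x: "x \<in> word_interval n c w" "x \<notin> G" for x
  proof -
    have "(\<exists>i\<in>{1..?N}. (real i - 1) * (?d + ?g) \<le> x - ?a \<and> x - ?a \<le> (real i - 1) * (?d + ?g) + ?d) \<or>
         (\<exists>j\<in>{1..<?N}. real j * ?d + (real j - 1) * ?g < x - ?a \<and> x - ?a < real j * ?d + real j * ?g)"
      using N x(1) split by (intro interval_subdivision) (auto simp: I)
    moreover have "\<not> (\<exists>j\<in>{1..<?N}. real j * ?d + (real j - 1) * ?g < x - ?a \<and> x - ?a < real j * ?d + real j * ?g)"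
      using x(2) by (force simp: G algebra_simps)
    ultimately obtain i where i: "i \<in> {1..?N}"
      "(real i - 1) * (?d + ?g) \<le> x - ?a" "x - ?a \<le> (real i - 1) * (?d + ?g) + ?d" by blast
    from i(2,3) have "x \<in> word_interval n c (w @ [i])" by (auto simp: child)
    then show ?thesis using i(1) by blast
  qed
  ultimately show "word_interval n c w - G = (\<Union>i\<in>{1..?N}. word_interval n c (w @ [i]))"
    by (intro equalityI subsetI) auto
qed

lemma word_interval_child_subset:
  assumes "w \<in> words n k" "i \<in> {1..n (Suc k)}"
  shows "word_interval n c (w @ [i]) \<subseteq> word_interval n c w"
  using word_interval_children(2)[OF assms(1)] assms(2) by blast

lemma word_intervals_disjoint:
  assumes "v \<in> words n k" "w \<in> words n k" "v \<noteq> w"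
  shows "word_interval n c v \<inter> word_interval n c w = {}"
  using assms
proof (induction k arbitrary: v w)
  case (Suc k)
  obtain v' i w' j where v: "v = v' @ [i]" "v' \<in> words n k" "i \<in> {1..n (Suc k)}"
    and w: "w = w' @ [j]" "w' \<in> words n k" "j \<in> {1..n (Suc k)}"
    using Suc.prems unfolding words_Suc by blast
  show ?case
  proof (cases "v' = w'")
    case True
    then have "i < j \<or> j < i" using v w Suc.prems(3) by auto
    moreover have "length w' = k" using w by (simp add: words_def)
    ultimately show ?thesis
      using word_interval_left_to_right[of w' k] v(1) w(1) True by fastforce
  next
    case False
    then show ?thesis
      using Suc.IH[OF v(2) w(2)] word_interval_child_subset[OF v(2,3)]
        word_interval_child_subset[OF w(2,3)] v(1) w(1) by blast
  qed
qed (simp add: words_0)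

lemma components_word_intervals:
  "components (\<Union>w\<in>words n k. word_interval n c w) = word_interval n c ` words n k"
proof (rule components_finite_disjoint_Union)
  show "pairwise disjnt (word_interval n c ` words n k)"
    using word_intervals_disjoint by (fastforce simp: pairwise_def disjnt_def)
  show "closed S \<and> connected S \<and> S \<noteq> {}" if S: "S \<in> word_interval n c ` words n k" for S
  proof -
    obtain w where "S = {word_left n c w .. word_left n c w + d (length w)}"
      using S by (auto simp: word_interval_def)
    then show ?thesis using comp_length_pos[of "length w"] by simp
  qed
qed (simp add: finite_words)

lemma cantor_level_words: "cantor_level n c k = (\<Union>w\<in>words n k. word_interval n c w)"
proof (induction k)
  case 0
  then show ?case by (simp add: words_0 word_interval_def word_left_def comp_length_0)
next
  case (Suc k)
  define G where "G w = \<Union>(deleted_gaps (n (Suc k)) (c (Suc k))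
                   (Inf (word_interval n c w)) (Sup (word_interval n c w)))" for w
  have "cantor_level n c (Suc k) = (\<Union>w\<in>words n k. word_interval n c w) - (\<Union>w\<in>words n k. G w)"
    using components_word_intervals[of k] by (simp add: Suc.IH G_def)
  also have "\<dots> = (\<Union>w\<in>words n k. word_interval n c w - G w)"
  proof (intro equalityI subsetI)
    fix x assume "x \<in> (\<Union>w\<in>words n k. word_interval n c w - G w)"
    then obtain w where w: "w \<in> words n k" "x \<in> word_interval n c w" "x \<notin> G w" by blast
    have "x \<notin> G v" if "v \<in> words n k" for v
    proof
      assume "x \<in> G v"
      then have "x \<in> word_interval n c v"
        using word_interval_children(1)[OF that] by (auto simp: G_def)
      then have "v = w" using word_intervals_disjoint[OF that w(1)] w(2) by blast
      then show False using w(3) \<open>x \<in> G v\<close> by simp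
    qed
    then show "x \<in> (\<Union>w\<in>words n k. word_interval n c w) - (\<Union>w\<in>words n k. G w)"
      using w by blast
  qed blast
  also have "\<dots> = (\<Union>w\<in>words n k. \<Union>i\<in>{1..n (Suc k)}. word_interval n c (w @ [i]))"
    using word_interval_children(2) by (simp add: G_def)
  also have "\<dots> = (\<Union>w\<in>words n (Suc k). word_interval n c w)"
    by (simp add: words_Suc)
  finally show ?case .
qed

lemma components_cantor_level: "components (cantor_level n c k) = word_interval n c ` words n k"
  by (simp add: cantor_level_words components_word_intervals)

lemma components_in_word_interval:
  assumes w: "w \<in> words n k"
  shows "{J \<in> components (cantor_level n c (Suc k)). J \<subseteq> word_interval n c w} =
           (\<lambda>i. word_interval n c (w @ [i])) ` {1..n (Suc k)}"
proof (intro equalityI subsetI)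
  fix J assume "J \<in> {J \<in> components (cantor_level n c (Suc k)). J \<subseteq> word_interval n c w}"
  then obtain v i where J: "J = word_interval n c (v @ [i])" "v \<in> words n k" "i \<in> {1..n (Suc k)}"
    and sub: "J \<subseteq> word_interval n c w"
    unfolding components_cantor_level words_Suc by blast
  have "J \<noteq> {}" using J(1) comp_length_pos[of "length (v @ [i])"] by (simp add: word_interval_def)
  moreover have "J \<subseteq> word_interval n c v" using word_interval_child_subset[OF J(2,3)] J(1) by simp
  ultimately have "v = w" using word_intervals_disjoint[OF J(2) w] sub by blast
  then show "J \<in> (\<lambda>i. word_interval n c (w @ [i])) ` {1..n (Suc k)}" using J by blast
next
  fix J assume "J \<in> (\<lambda>i. word_interval n c (w @ [i])) ` {1..n (Suc k)}"
  then show "J \<in> {J \<in> components (cantor_level n c (Suc k)). J \<subseteq> word_interval n c w}"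
    using w word_interval_child_subset[OF w] unfolding components_cantor_level words_Suc by blast
qed

lemma comp_length_decreasing: "i < j \<Longrightarrow> d j < d i"
proof (induction j rule: less_Suc_induct)
  case (1 i)
  then show ?case using comp_length_half[of i] comp_length_pos[of "Suc i"] by linarith
qed simp

lemma comp_length_tendsto_0: "(\<lambda>k. d k) \<longlonglongrightarrow> 0"
proof (rule tendsto_sandwich[of "\<lambda>_. 0" _ _ "\<lambda>k. (1/2::real) ^ k"])
  have "d k \<le> (1/2) ^ k" for k
  proof (induction k)
    case (Suc k)
    then show ?case using comp_length_half[of k] by simp
  qed (simp add: comp_length_0)
  then show "\<forall>\<^sub>F k in sequentially. d k \<le> (1/2) ^ k" by simp
  show "\<forall>\<^sub>F k in sequentially. 0 \<le> d k" using comp_length_pos by (simp add: less_imp_le)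
qed (auto intro: LIMSEQ_power_zero)

lemma depth_idx_unique:
  assumes k: "k \<in> large_gap_levels n c"
  shows "\<exists>!m. 1 \<le> m \<and> d (k + m) \<le> g k \<and> g k < d (k + m - 1)"
proof -
  have gk: "0 < g k" "g k < d k" using k gap_length_pos by (auto simp: large_gap_levels_def)
  have "\<forall>\<^sub>F i in sequentially. d i < g k"
    using order_tendstoD(2)[OF comp_length_tendsto_0 gk(1)] .
  then obtain N where N: "\<And>i. i \<ge> N \<Longrightarrow> d i < g k" by (auto simp: eventually_sequentially)
  define m where "m = (LEAST m. d (k + m) \<le> g k)"
  have m: "d (k + m) \<le> g k"
    unfolding m_def by (rule LeastI[of _ N]) (use N[of "k + N"] in simp)
  have less: "\<not> d (k + i) \<le> g k" if "i < m" for i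
    using not_less_Least[of i "\<lambda>m. d (k + m) \<le> g k"] that by (simp add: m_def)
  have m1: "1 \<le> m" using m gk by (cases m) auto
  show ?thesis
  proof (rule ex1I[of _ m])
    show "1 \<le> m \<and> d (k + m) \<le> g k \<and> g k < d (k + m - 1)"
      using m m1 less[of "m - 1"] by auto
    fix m' assume m': "1 \<le> m' \<and> d (k + m') \<le> g k \<and> g k < d (k + m' - 1)"
    have "\<not> m' < m" using less m' by blast
    moreover have "\<not> m < m'"
    proof
      assume "m < m'"
      then have "k + m = k + m' - 1 \<or> k + m < k + m' - 1" by linarith
      then have "d (k + m' - 1) \<le> d (k + m)"
        using comp_length_decreasing[of "k + m" "k + m' - 1"] by force
      then show False using m m' by linarith
    qed
    ultimately show "m' = m" by simp
  qed
qed

lemma block_idx_unique: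
  assumes k: "k \<in> large_gap_levels n c"
  defines "m \<equiv> depth_idx n c k"
  shows "\<exists>!s::nat. 1 \<le> s \<and> real s * d (k + m) + (real s - 1) * g (k + m) \<le> g k \<and>
           g k < (real s + 1) * d (k + m) + real s * g (k + m)"
proof -
  have m: "1 \<le> m \<and> d (k + m) \<le> g k \<and> g k < d (k + m - 1)"
    unfolding m_def depth_idx_def by (rule theI'[OF depth_idx_unique[OF k]])
  define D where "D = d (k + m) + g (k + m)"
  have D: "0 < D" using comp_length_pos[of "k + m"] gap_length_pos[of "k + m"] m
    unfolding D_def by (intro add_pos_pos) auto
  have eq: "(1 \<le> s \<and> real s * d (k + m) + (real s - 1) * g (k + m) \<le> g k \<and>
           g k < (real s + 1) * d (k + m) + real s * g (k + m)) \<longleftrightarrow>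
        1 \<le> s \<and> \<lfloor>(g k + g (k + m)) / D\<rfloor> = int s" for s :: nat
    using D by (simp add: floor_eq_iff field_simps) (auto simp: D_def algebra_simps)
  have "1 \<le> (g k + g (k + m)) / D" using m D by (simp add: D_def)
  then have "1 \<le> \<lfloor>(g k + g (k + m)) / D\<rfloor>" by simp
  then have "1 \<le> nat \<lfloor>(g k + g (k + m)) / D\<rfloor>" by linarith
  then show ?thesis unfolding eq by (intro ex1I[of _ "nat \<lfloor>(g k + g (k + m)) / D\<rfloor>"]) auto
qed

end

end

theory Submission
  imports Defs
begin

text \<open>
  Doubling compares the masses of two concentric balls, uniformity compares the masses of runs of
  consecutive components, and the two comparisons are equivalent scale by scale.  If
  \<open>\<delta> (q + 1) < r \<le> \<delta> q\<close>, a ball of radius \<open>r\<close> centred in \<open>E\<close> contains a run of \<open>l\<close> siblings of level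
  \<open>q + 1\<close> with \<open>r \<le> 2 l \<sigma>\<close>, where \<open>\<sigma>\<close> is the distance between the left endpoints of consecutive siblings,
  and everything in the doubled ball lies within boundedly many lengths \<open>l \<sigma>\<close> of this run.

  \<^bold>\<open>Doubling implies uniformity.\<close>  The key is \<open>run_ball\<close>: a run of \<open>l\<close> siblings carries a fixed share of
  the mass of the ball of radius \<open>16 l \<sigma>\<close> around its left endpoint.  This is immediate from doubling if
  some point of \<open>E\<close> has a distance comparable to \<open>l \<sigma>\<close> from everything outside the run.  Otherwise the run
  has at most two components; either these are very short compared with the gap between siblings, or a
  single component may be replaced by the run of its children.  Near a very short component
  (\<open>thin_component\<close>) all that \<open>E\<close> contains apart from the component itself is one more piece of at most the
  same length on one side, and a pair of balls adapted to the distance of the two pieces settles the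
  matter.  Every window of a (concatenated) ratio vector contains a run of at least half its length in a
  single parent, and a touching window lies in the ball around that run, provided that the gap between
  the parents is not longer than the window.
  The block length \<open>s\<^sub>k\<close> is the length from which on this is true, up to a constant.

  \<^bold>\<open>Uniformity implies doubling.\<close>  Here \<open>adjacent_mass\<close> shows that neighbouring components of one level have
  comparable masses if the gap between them is shorter than two components, and \<open>pair_cover\<close> that a window in
  one of two neighbours controls the cells of both that are near it.  The first handles the balls that
  swallow a fixed share of a component of level \<open>q\<close>, the second those that reach at most its two
  neighbours.  A ball reaches a neighbour only by crossing the gap, so its run is at least a quarter of
  the block length, and the restriction to windows of at least \<open>s\<^sub>k\<close> cells costs only a constant.
\<close>

section \<open>Components and points of uniform Cantor sets\<close>

locale uniform_cantor =
  fixes n :: "nat \<Rightarrow> nat" and c :: "nat \<Rightarrow> real"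
  assumes params: "cantor_params n c"
begin

abbreviation "\<delta> \<equiv> comp_length n c"
abbreviation "\<epsilon> \<equiv> gap_length n c"
abbreviation "I \<equiv> word_interval n c"
abbreviation "lft \<equiv> word_left n c"
abbreviation "E \<equiv> cantor_set n c"

definition rgt :: "nat list \<Rightarrow> real" where "rgt w = lft w + \<delta> (length w)"

text \<open>
  The distance between the left endpoints of consecutive siblings of level \<open>k\<close>; in this unit a run of
  \<open>l\<close> siblings has length \<open>l \<sigma> - \<epsilon>\<close>.
\<close>

definition period :: "nat \<Rightarrow> real" (\<open>\<sigma>\<close>) where "\<sigma> k = \<delta> k + \<epsilon> k"

lemma \<delta>_pos: "0 < \<delta> k" by (rule comp_length_pos[OF params])
lemma \<epsilon>_pos: "1 \<le> k \<Longrightarrow> 0 < \<epsilon> k" by (rule gap_length_pos[OF params])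
lemma n_ge_2: "1 \<le> k \<Longrightarrow> 2 \<le> n k" using param_facts[OF params] by blast

lemma \<sigma>_bounds: "1 \<le> k \<Longrightarrow> \<delta> k < \<sigma> k" "1 \<le> k \<Longrightarrow> \<epsilon> k < \<sigma> k" "1 \<le> k \<Longrightarrow> 0 < \<sigma> k"
  using \<delta>_pos[of k] \<epsilon>_pos[of k] by (auto simp: period_def)

lemma \<delta>_split: "\<delta> k = real (n (Suc k)) * \<sigma> (Suc k) - \<epsilon> (Suc k)"
  using comp_length_split[OF params, of k] by (simp add: period_def algebra_simps)

lemma \<delta>_antimono: "i \<le> j \<Longrightarrow> \<delta> j \<le> \<delta> i"
  using comp_length_decreasing[OF params, of i j] by (cases "i = j") auto

lemma \<delta>_halves: "2 * \<delta> (Suc k) < \<delta> k"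
proof -
  have "2 * \<sigma> (Suc k) \<le> real (n (Suc k)) * \<sigma> (Suc k)"
    using n_ge_2[of "Suc k"] \<sigma>_bounds[of "Suc k"] by (intro mult_right_mono) auto
  then show ?thesis using \<delta>_split[of k] \<epsilon>_pos[of "Suc k"] by (simp add: period_def)
qed

lemma I_eq: "I w = {lft w .. rgt w}"
  by (simp add: word_interval_def rgt_def)

lemma mem_I: "x \<in> I w \<longleftrightarrow> lft w \<le> x \<and> x \<le> rgt w"
  by (simp add: I_eq)

lemma lft_Nil [simp]: "lft [] = 0" and rgt_Nil [simp]: "rgt [] = 1"
  by (simp_all add: word_left_def rgt_def comp_length_0[OF params])

lemma lft_less_rgt: "lft w < rgt w"
  using \<delta>_pos by (simp add: rgt_def)

lemma words_length: "w \<in> words n k \<Longrightarrow> length w = k"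
  by (simp add: words_def)

lemma words_snoc: "w @ [i] \<in> words n (Suc k) \<longleftrightarrow> w \<in> words n k \<and> 1 \<le> i \<and> i \<le> n (Suc k)"
  unfolding words_Suc[OF params] by fastforce

text \<open>
  From here on, children are written \<open>w @ [Suc z]\<close> with \<open>z\<close> counted from \<open>0\<close>: the left endpoint is then at
  distance \<open>z \<sigma>\<close> from that of the parent, and \<open>z\<close> is the index in the ratio vector.
\<close>

lemma words_child: "w \<in> words n k \<Longrightarrow> z < n (Suc k) \<Longrightarrow> w @ [Suc z] \<in> words n (Suc k)"
  by (simp add: words_snoc)

lemma lft_child: "lft (w @ [Suc z]) = lft w + real z * \<sigma> (Suc (length w))"
  by (simp add: word_left_snoc[OF params] period_def)

lemma rgt_child: "rgt (w @ [Suc z]) = lft w + real z * \<sigma> (Suc (length w)) + \<delta> (Suc (length w))"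
  by (simp add: rgt_def lft_child)

lemma rgt_eq: "rgt w = lft w + real (n (Suc (length w))) * \<sigma> (Suc (length w)) - \<epsilon> (Suc (length w))"
  using \<delta>_split by (simp add: rgt_def)

lemma lft_first_child: "lft (w @ [1]) = lft w"
  using lft_child[of w 0] by simp

lemma rgt_last_child: "rgt (w @ [n (Suc (length w))]) = rgt w"
proof -
  obtain m where m: "n (Suc (length w)) = Suc m" using n_ge_2[of "Suc (length w)"] by (cases "n (Suc (length w))") auto
  show ?thesis unfolding rgt_eq[of w] m by (simp add: rgt_child period_def algebra_simps)
qed

lemma E_word:
  assumes "x \<in> E" obtains w where "w \<in> words n k" "x \<in> I w"
proof -
  have "x \<in> cantor_level n c k" using assms by (auto simp: cantor_set_def)
  then show ?thesis using that by (auto simp: cantor_level_words[OF params])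
qed

lemma words_disjoint: "v \<in> words n k \<Longrightarrow> w \<in> words n k \<Longrightarrow> x \<in> I v \<Longrightarrow> x \<in> I w \<Longrightarrow> v = w"
  using word_intervals_disjoint[OF params, of v k w] by blast

lemma child_subset: "w \<in> words n k \<Longrightarrow> 1 \<le> i \<Longrightarrow> i \<le> n (Suc k) \<Longrightarrow> I (w @ [i]) \<subseteq> I w"
  using word_interval_child_subset[OF params, of w k i] by simp

lemma E_child:
  assumes "x \<in> E" "w \<in> words n k" "x \<in> I w"
  obtains z where "z < n (Suc k)" "x \<in> I (w @ [Suc z])"
proof -
  obtain u where u: "u \<in> words n (Suc k)" "x \<in> I u" using E_word assms(1) by blast
  then obtain w' i where w': "u = w' @ [i]" "w' \<in> words n k" "i \<in> {1..n (Suc k)}"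
    by (auto simp: words_Suc[OF params])
  have "x \<in> I w'" using child_subset[OF w'(2), of i] w' u by auto
  then have "w' = w" using words_disjoint w'(2) assms by blast
  then show ?thesis using that[of "i - 1"] w' u by auto
qed

lemma level_antimono: "j \<le> k \<Longrightarrow> cantor_level n c k \<subseteq> cantor_level n c j"
  by (induction k rule: dec_induct) auto

text \<open>
  An endpoint of an interval survives all later deletions, because it is also an endpoint of the first
  or the last child.
\<close>

lemma endpoint_in_E:
  assumes w: "w \<in> words n k" shows "lft w \<in> E" "rgt w \<in> E"
proof -
  have "\<exists>u\<in>words n (k + t). lft u = lft w" for t
  proof (induction t)
    case (Suc t)
    then obtain u where "u \<in> words n (k + t)" "lft u = lft w" by blast
    then show ?case using lft_first_child[of u] n_ge_2[of "Suc (k + t)"]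
      by (intro bexI[of _ "u @ [1]"]) (auto simp: words_snoc)
  qed (use w in auto)
  then have L: "lft w \<in> cantor_level n c (k + t)" for t
    unfolding cantor_level_words[OF params] using lft_less_rgt by (metis UN_I mem_I less_imp_le order_refl)
  have "\<exists>u\<in>words n (k + t). rgt u = rgt w" for t
  proof (induction t)
    case (Suc t)
    then obtain u where "u \<in> words n (k + t)" "rgt u = rgt w" by blast
    then show ?case using rgt_last_child[of u] n_ge_2[of "Suc (k + t)"]
      by (intro bexI[of _ "u @ [n (Suc (length u))]"]) (auto simp: words_snoc words_length)
  qed (use w in auto)
  then have R: "rgt w \<in> cantor_level n c (k + t)" for t
    unfolding cantor_level_words[OF params] using lft_less_rgt by (metis UN_I mem_I less_imp_le order_refl)
  show "lft w \<in> E" "rgt w \<in> E"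
    unfolding cantor_set_def using L R level_antimono by (meson INT_I le_add2 subsetD)+
qed

lemma closed_E: "closed E"
  unfolding cantor_set_def
  by (intro closed_INT ballI) (auto simp: cantor_level_words[OF params] I_eq finite_words[OF params] intro!: closed_UN)

lemma E_bounds: "x \<in> E \<Longrightarrow> 0 \<le> x \<and> x \<le> 1"
  using E_word[of x 0] by (metis lft_Nil rgt_Nil mem_I singletonD words_0[OF params])

lemma words_separated:
  assumes "u \<in> words n k" "v \<in> words n k" "u \<noteq> v"
  shows "rgt u < lft v \<or> rgt v < lft u"
proof (rule ccontr)
  assume "\<not> ?thesis"
  then have "max (lft u) (lft v) \<in> I u" "max (lft u) (lft v) \<in> I v"
    using lft_less_rgt[of u] lft_less_rgt[of v] by (auto simp: mem_I)
  then show False using words_disjoint assms by blast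
qed

text \<open>
  Of three points in different components of one level, the middle one has a whole component to itself
  between the other two.
\<close>

lemma three_words_spread:
  assumes "u \<in> words n k" "v \<in> words n k" "w \<in> words n k" "u \<noteq> v" "v \<noteq> w" "u \<noteq> w"
    and "x \<in> I u" "y \<in> I v" "z \<in> I w"
  shows "\<delta> k < \<bar>x - y\<bar> \<or> \<delta> k < \<bar>y - z\<bar> \<or> \<delta> k < \<bar>x - z\<bar>"
  using words_separated[OF assms(1,2,4)] words_separated[OF assms(2,3,5)]
    words_separated[OF assms(1,3,6)] assms(7-9)
  by (auto simp: mem_I rgt_def words_length[OF assms(1)] words_length[OF assms(2)] words_length[OF assms(3)])

lemma children_separated:
  assumes "z < z'" "x \<in> I (w @ [Suc z])" "y \<in> I (w @ [Suc z'])" "length w = k"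
  shows "real (z' - z - 1) * \<sigma> (Suc k) + \<epsilon> (Suc k) \<le> y - x"
proof -
  have "real (z' - z - 1) = real z' - real z - 1" using assms(1) by auto
  then show ?thesis using assms(2-4)
    by (auto simp: mem_I rgt_child lft_child period_def algebra_simps)
qed

section \<open>Neighbouring components and the gap between them\<close>

lemma max_word_ext_0 [simp]: "max_word_ext n v 0 = v"
  by (simp add: max_word_ext_def)

lemma max_word_ext_Suc: "max_word_ext n v (Suc t) = max_word_ext n v t @ [n (Suc (length v + t))]"
  by (simp add: max_word_ext_def)

lemma min_word_ext_0 [simp]: "min_word_ext v 0 = v"
  by (simp add: min_word_ext_def)

lemma min_word_ext_Suc: "min_word_ext v (Suc t) = min_word_ext v t @ [Suc 0]"
  by (simp add: min_word_ext_def replicate_append_same)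

lemma length_word_ext [simp]:
  "length (max_word_ext n v t) = length v + t" "length (min_word_ext v t) = length v + t"
  by (simp_all add: max_word_ext_def min_word_ext_def)

lemma word_ext_words:
  assumes "v \<in> words n k"
  shows "max_word_ext n v t \<in> words n (k + t)" "min_word_ext v t \<in> words n (k + t)"
  using n_ge_2[of "Suc (k + _)"] assms
  by (induction t)
     (auto simp: max_word_ext_Suc min_word_ext_Suc words_snoc words_length intro: order_trans[OF _ n_ge_2])

lemma rgt_max_word_ext [simp]: "rgt (max_word_ext n v t) = rgt v"
proof (induction t)
  case (Suc t)
  then show ?case using rgt_last_child[of "max_word_ext n v t"] by (simp add: max_word_ext_Suc)
qed simp

lemma lft_min_word_ext [simp]: "lft (min_word_ext v t) = lft v"
proof (induction t)
  case (Suc t)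
  then show ?case using lft_first_child[of "min_word_ext v t"] by (simp add: min_word_ext_Suc)
qed simp

lemma lft_sibling: "lft (w @ [Suc (Suc z)]) = rgt (w @ [Suc z]) + \<epsilon> (Suc (length w))"
  by (simp add: lft_child rgt_child period_def algebra_simps)

lemma sibling_ext:
  fixes t :: nat
  assumes w: "w \<in> words n k" and i: "1 \<le> i" "i < n (Suc k)"
  defines "v \<equiv> max_word_ext n (w @ [i]) t" and "v' \<equiv> min_word_ext (w @ [i + 1]) t"
  shows "v \<in> words n (Suc k + t)" "v' \<in> words n (Suc k + t)" "lft v' = rgt v + \<epsilon> (Suc k)" "v \<noteq> v'"
proof -
  have "w @ [i] \<in> words n (Suc k)" "w @ [i + 1] \<in> words n (Suc k)" using w i by (auto simp: words_snoc)
  then show vv: "v \<in> words n (Suc k + t)" "v' \<in> words n (Suc k + t)"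
    unfolding v_def v'_def by (blast intro: word_ext_words)+
  obtain z where z: "i = Suc z" using i by (cases i) auto
  show g: "lft v' = rgt v + \<epsilon> (Suc k)"
    using lft_sibling[of w z] words_length[OF w] by (simp add: v_def v'_def z)
  show "v \<noteq> v'" using g lft_less_rgt[of v] \<epsilon>_pos[of "Suc k"] by auto
qed

text \<open>
  Neighbours of level \<open>q\<close> are described by words rather than by position because the level at which their
  words part decides how long the gap \<open>\<gamma>\<close> between them is and which of the conditions of the criterion
  speaks about the pair.
\<close>

definition adjacent :: "nat list \<Rightarrow> nat list \<Rightarrow> real \<Rightarrow> nat \<Rightarrow> bool" where
  "adjacent v v' \<gamma> q \<longleftrightarrow> (\<exists>k w i t. w \<in> words n k \<and> 1 \<le> i \<and> i < n (Suc k) \<and> q = Suc k + t \<and>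
     \<gamma> = \<epsilon> (Suc k) \<and> v = max_word_ext n (w @ [i]) t \<and> v' = min_word_ext (w @ [i + 1]) t)"

lemma adjacent_props:
  assumes "adjacent v v' \<gamma> q"
  shows "v \<in> words n q" "v' \<in> words n q" "v \<noteq> v'" "lft v' = rgt v + \<gamma>" "0 < \<gamma>"
proof -
  obtain k w i t where w: "w \<in> words n k" "1 \<le> i" "i < n (Suc k)" and
    q: "q = Suc k + t" "\<gamma> = \<epsilon> (Suc k)" "v = max_word_ext n (w @ [i]) t" "v' = min_word_ext (w @ [i + 1]) t"
    using assms unfolding adjacent_def by blast
  show "v \<in> words n q" "v' \<in> words n q" "v \<noteq> v'" "lft v' = rgt v + \<gamma>" "0 < \<gamma>"
    using sibling_ext[OF w, of t] \<epsilon>_pos[of "Suc k"] unfolding q by auto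
qed

lemma adjacent_gap_empty:
  assumes "adjacent v v' \<gamma> q" "x \<in> E"
  shows "x \<le> rgt v \<or> lft v' \<le> x"
proof (rule ccontr)
  assume nx: "\<not> ?thesis"
  obtain k w i t where w: "w \<in> words n k" "1 \<le> i" "i < n (Suc k)" and
    q: "v = max_word_ext n (w @ [i]) t" "v' = min_word_ext (w @ [i + 1]) t"
    using assms(1) unfolding adjacent_def by blast
  obtain j where j: "i = Suc j" using w by (cases i) auto
  have len: "length w = k" using w words_length by auto
  let ?s = "\<sigma> (Suc k)"
  have s: "0 < ?s" "?s = \<delta> (Suc k) + \<epsilon> (Suc k)" using \<sigma>_bounds by (auto simp: period_def)
  have x: "lft w + real j * ?s + \<delta> (Suc k) < x" "x < lft w + (real j + 1) * ?s"
    using nx unfolding q j by (auto simp: lft_child rgt_child len algebra_simps)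
  have "(real j + 2) * ?s \<le> real (n (Suc k)) * ?s" "0 \<le> real j * ?s"
    using w j s(1) by (auto intro!: mult_right_mono)
  moreover have "(real j + 1) * ?s = (real j + 2) * ?s - ?s" by (simp add: algebra_simps)
  ultimately have "x \<in> I w"
    using x s \<delta>_pos[of "Suc k"] rgt_eq[of w] unfolding mem_I len by linarith
  then obtain z where z: "x \<in> I (w @ [Suc z])" using E_child[OF assms(2) w(1)] by blast
  then have zx: "lft w + real z * ?s \<le> x" "x \<le> lft w + real z * ?s + \<delta> (Suc k)"
    by (simp_all add: mem_I lft_child rgt_child len)
  have "real j * ?s < real z * ?s" "real z * ?s < (real j + 1) * ?s" using zx x by linarith+
  then have "real j < real z" "real z < real j + 1" using s(1) by (simp_all only: mult_less_cancel_right_pos)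
  then have "real j < real z" "real z < real (Suc j)" by simp_all
  then have "j < z" "z < Suc j" by (simp_all only: of_nat_less_iff)
  then show False by simp
qed

text \<open>
  A component that is the first child of its parent has the last child of the parent's neighbour as its
  neighbour, so the claim passes from level to level; dually on the right.
\<close>

lemma left_neighbour:
  assumes "w \<in> words n q"
  shows "lft w = 0 \<or> (\<exists>v \<gamma>. adjacent v w \<gamma> q)"
  using assms
proof (induction q arbitrary: w)
  case (Suc q)
  then obtain w0 a where w: "w = w0 @ [a]" "w0 \<in> words n q" "1 \<le> a" "a \<le> n (Suc q)"
    unfolding words_Suc[OF params] by fastforce
  show ?case
  proof (cases "a = 1")
    case True
    show ?thesis
    proof (cases "lft w0 = 0")
      case True
      then show ?thesis using \<open>a = 1\<close> w lft_first_child by simp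
    next
      case False
      then obtain v \<gamma> where "adjacent v w0 \<gamma> q" using Suc.IH w(2) by blast
      then obtain k u i t where u: "u \<in> words n k" "1 \<le> i" "i < n (Suc k)" "q = Suc k + t"
          "w0 = min_word_ext (u @ [i + 1]) t"
        unfolding adjacent_def by blast
      have "adjacent (max_word_ext n (u @ [i]) (Suc t)) w (\<epsilon> (Suc k)) (Suc q)"
        unfolding adjacent_def using u w(1) \<open>a = 1\<close>
        by (intro exI[of _ k] exI[of _ u] exI[of _ i] exI[of _ "Suc t"]) (simp add: min_word_ext_Suc)
      then show ?thesis by blast
    qed
  next
    case False
    then have "adjacent (w0 @ [a - 1]) w (\<epsilon> (Suc q)) (Suc q)"
      unfolding adjacent_def using w
      by (intro exI[of _ q] exI[of _ w0] exI[of _ "a - 1"] exI[of _ 0]) auto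
    then show ?thesis by blast
  qed
qed (simp add: words_0[OF params])

lemma right_neighbour:
  assumes "v \<in> words n q"
  shows "rgt v = 1 \<or> (\<exists>w \<gamma>. adjacent v w \<gamma> q)"
  using assms
proof (induction q arbitrary: v)
  case (Suc q)
  then obtain v0 a where v: "v = v0 @ [a]" "v0 \<in> words n q" "1 \<le> a" "a \<le> n (Suc q)"
    unfolding words_Suc[OF params] by fastforce
  have len: "length v0 = q" using v words_length by auto
  show ?case
  proof (cases "a = n (Suc q)")
    case True
    show ?thesis
    proof (cases "rgt v0 = 1")
      case True
      then show ?thesis using \<open>a = n (Suc q)\<close> v rgt_last_child[of v0] len by simp
    next
      case False
      then obtain w \<gamma> where "adjacent v0 w \<gamma> q" using Suc.IH v(2) by blast
      then obtain k u i t where u: "u \<in> words n k" "1 \<le> i" "i < n (Suc k)" "q = Suc k + t"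
          "v0 = max_word_ext n (u @ [i]) t"
        unfolding adjacent_def by blast
      have "adjacent v (min_word_ext (u @ [i + 1]) (Suc t)) (\<epsilon> (Suc k)) (Suc q)"
        unfolding adjacent_def using u v(1) \<open>a = n (Suc q)\<close> words_length[OF u(1)]
        by (intro exI[of _ k] exI[of _ u] exI[of _ i] exI[of _ "Suc t"]) (simp add: max_word_ext_Suc)
      then show ?thesis by blast
    qed
  next
    case False
    then have "adjacent v (v0 @ [a + 1]) (\<epsilon> (Suc q)) (Suc q)"
      unfolding adjacent_def using v
      by (intro exI[of _ q] exI[of _ v0] exI[of _ a] exI[of _ 0]) auto
    then show ?thesis by blast
  qed
qed (simp add: words_0[OF params])

text \<open>
  The children of \<open>v\<close> followed by those of \<open>w\<close> in one sequence, which is the indexing of the concatenated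
  ratio vector.  Every estimate about two neighbours becomes one about index distances.
\<close>

definition cell :: "nat list \<Rightarrow> nat list \<Rightarrow> nat \<Rightarrow> nat list" where
  "cell v w z = (let N = n (Suc (length v)) in if z < N then v @ [Suc z] else w @ [Suc (z - N)])"

lemma cell_simps:
  "length v = k \<Longrightarrow> z < n (Suc k) \<Longrightarrow> cell v w z = v @ [Suc z]"
  "length v = k \<Longrightarrow> cell v w (n (Suc k) + z) = w @ [Suc z]"
  by (simp_all add: cell_def)

lemma cell_words:
  "v \<in> words n k \<Longrightarrow> w \<in> words n k \<Longrightarrow> z < 2 * n (Suc k) \<Longrightarrow> cell v w z \<in> words n (Suc k)"
  by (auto simp: cell_def words_length Let_def words_snoc)

lemma inj_on_cell:
  "v \<in> words n k \<Longrightarrow> w \<in> words n k \<Longrightarrow> v \<noteq> w \<Longrightarrow> inj_on (cell v w) {..<2 * n (Suc k)}"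
  by (auto simp: cell_def words_length Let_def inj_on_def split: if_splits)

lemma lft_cell:
  assumes "v \<in> words n k" "w \<in> words n k" "lft w = rgt v + \<gamma>"
  shows "lft (cell v w z) =
    lft v + real z * \<sigma> (Suc k) + (if z < n (Suc k) then 0 else \<gamma> - \<epsilon> (Suc k))"
proof -
  have "real (z - n (Suc k)) = real z - real (n (Suc k))" if "\<not> z < n (Suc k)"
    using that by auto
  then show ?thesis using assms rgt_eq[of v]
    by (simp add: cell_def words_length lft_child Let_def algebra_simps)
qed

text \<open>
  Distances of cells are index distances in the unit \<open>\<sigma>\<close>, up to two units and the gap between the
  parents.  The gap enters only the upper bound: it may be much shorter than the gaps between siblings.
\<close>

lemma cell_distance:
  assumes "v \<in> words n k" "w \<in> words n k" "lft w = rgt v + \<gamma>" "0 \<le> \<gamma>"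
    and "z < 2 * n (Suc k)" "z' < 2 * n (Suc k)" "z \<le> z'" "x \<in> I (cell v w z)" "y \<in> I (cell v w z')"
  shows "(real z' - real z - 2) * \<sigma> (Suc k) \<le> y - x"
    and "\<bar>y - x\<bar> \<le> (real z' - real z + 1) * \<sigma> (Suc k) + \<gamma>"
proof -
  have len: "length (cell v w z) = Suc k" "length (cell v w z') = Suc k"
    using cell_words assms words_length by blast+
  have "(real z' - real z) * \<sigma> (Suc k) \<ge> \<sigma> (Suc k)" if "z < z'"
  proof -
    have "1 * \<sigma> (Suc k) \<le> (real z' - real z) * \<sigma> (Suc k)"
      using that \<sigma>_bounds[of "Suc k"] by (intro mult_right_mono) auto
    then show ?thesis by simp
  qed
  then show "(real z' - real z - 2) * \<sigma> (Suc k) \<le> y - x"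
    "\<bar>y - x\<bar> \<le> (real z' - real z + 1) * \<sigma> (Suc k) + \<gamma>"
    using assms(7-9,4) lft_cell[OF assms(1-3), of z] lft_cell[OF assms(1-3), of z']
      \<sigma>_bounds[of "Suc k"] \<delta>_pos[of "Suc k"] \<epsilon>_pos[of "Suc k"]
    by (cases "z = z'"; auto simp: mem_I rgt_def len algebra_simps period_def split: if_splits)+
qed

section \<open>Scales\<close>

lemma depth_idx_props:
  assumes "k \<in> large_gap_levels n c"
  shows "1 \<le> depth_idx n c k" "\<delta> (k + depth_idx n c k) \<le> \<epsilon> k" "\<epsilon> k < \<delta> (k + depth_idx n c k - 1)"
  using theI'[OF depth_idx_unique[OF params assms]] unfolding depth_idx_def by blast+

lemma block_idx_props:
  assumes "k \<in> large_gap_levels n c"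
  defines "q \<equiv> k + depth_idx n c k"
  shows "1 \<le> block_idx n c k"
    "real (block_idx n c k) * \<sigma> q - \<epsilon> q \<le> \<epsilon> k"
    "\<epsilon> k < (real (block_idx n c k) + 1) * \<sigma> q"
    "block_idx n c k < n q"
proof -
  have s: "1 \<le> block_idx n c k \<and>
    real (block_idx n c k) * \<delta> q + (real (block_idx n c k) - 1) * \<epsilon> q \<le> \<epsilon> k \<and>
    \<epsilon> k < (real (block_idx n c k) + 1) * \<delta> q + real (block_idx n c k) * \<epsilon> q"
    unfolding block_idx_def Let_def q_def by (rule theI'[OF block_idx_unique[OF params assms(1)]])
  have q: "1 \<le> q" "Suc (q - 1) = q"
    using depth_idx_props(1)[OF assms(1)] by (auto simp: q_def)
  show "1 \<le> block_idx n c k" using s by blast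
  show 2: "real (block_idx n c k) * \<sigma> q - \<epsilon> q \<le> \<epsilon> k"
    using s by (simp add: period_def algebra_simps)
  show "\<epsilon> k < (real (block_idx n c k) + 1) * \<sigma> q"
    using s \<epsilon>_pos[OF q(1)] by (simp add: period_def algebra_simps)
  \<comment> \<open>\<open>\<epsilon> k\<close> is shorter than the parent, so the block fits into it with room to spare\<close>
  have "real (block_idx n c k) * \<sigma> q < real (n q) * \<sigma> q"
    using 2 depth_idx_props(3)[OF assms(1)] \<delta>_split[of "q - 1"]
    unfolding q(2) q_def[symmetric] by linarith
  then show "block_idx n c k < n q"
    using \<sigma>_bounds(3)[OF q(1)] by simp
qed

lemma less_depth_idx:
  assumes "k \<in> large_gap_levels n c" "t < depth_idx n c k"
  shows "\<epsilon> k < \<delta> (k + t)"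
  using depth_idx_props(3)[OF assms(1)] \<delta>_antimono[of "k + t" "k + depth_idx n c k - 1"] assms(2)
  by fastforce

lemma level_of_scale:
  assumes "0 < r" "r \<le> 1"
  obtains q where "\<delta> (Suc q) < r" "r \<le> \<delta> q"
proof -
  have "\<forall>\<^sub>F i in sequentially. \<delta> i < r"
    using order_tendstoD(2)[OF comp_length_tendsto_0[OF params] assms(1)] .
  then obtain N where N: "\<delta> N < r" by (auto simp: eventually_sequentially)
  define p where "p = (LEAST p. \<delta> p < r)"
  have p: "\<delta> p < r" unfolding p_def using N by (rule LeastI)
  have "p \<noteq> 0"
  proof
    assume "p = 0"
    then show False using p assms(2) comp_length_0[OF params] by simp
  qed
  then obtain q where q: "p = Suc q" by (cases p) auto
  have "\<not> \<delta> q < r" using not_less_Least[of q "\<lambda>p. \<delta> p < r"] q by (simp add: p_def)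
  then show ?thesis using that[of q] p q by simp
qed

text \<open>
  A ball at the scale of level \<open>q\<close> contains a run of children that is long enough to be compared with the
  ball: it has either as many children as the radius allows on one side, or all of them.
\<close>

lemma children_in_ball:
  assumes w: "w \<in> words n q" and x: "z0 < n (Suc q)" "x \<in> I (w @ [Suc z0])"
    and r: "\<delta> (Suc q) < r" "r \<le> \<delta> q"
  obtains a l where "1 \<le> l" "a + l \<le> n (Suc q)" "a \<le> z0" "z0 < a + l"
    "r \<le> 2 * (real l * \<sigma> (Suc q))" "\<And>z. z \<in> {a..<a+l} \<Longrightarrow> I (w @ [Suc z]) \<subseteq> ball x r"
proof -
  let ?s = "\<sigma> (Suc q)" and ?d = "\<delta> (Suc q)" and ?n = "n (Suc q)"
  have len: "length w = q" using w words_length by auto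
  have pos: "0 < ?s" "0 < ?d" "?d < ?s" using \<sigma>_bounds \<delta>_pos by auto
  \<comment> \<open>\<open>h\<close> is the largest number of steps to a sibling that is certain to stay in the ball\<close>
  define h where "h = nat (\<lceil>(r - ?d) / ?s\<rceil> - 1)"
  have "0 < (r - ?d) / ?s" using r pos by simp
  then have "1 \<le> \<lceil>(r - ?d) / ?s\<rceil>" by linarith
  then have "real h < (r - ?d) / ?s" "(r - ?d) / ?s \<le> real h + 1" unfolding h_def by linarith+
  then have h: "real h * ?s + ?d < r" "r \<le> (real h + 1) * ?s + ?d"
    using pos by (simp_all add: pos_less_divide_eq pos_divide_le_eq)
  define l where "l = min ?n (h + 1)"
  define a where "a = min z0 (?n - l)"
  have l: "1 \<le> l" "l \<le> ?n" using x by (auto simp: l_def)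
  have rl: "r \<le> 2 * (real l * ?s)"
  proof (cases "h + 1 \<le> ?n")
    case True
    then have "real l = real h + 1" by (simp add: l_def)
    then have "(real h + 1) * ?s = real l * ?s" by simp
    moreover have "1 * ?s \<le> real l * ?s" using l pos by (intro mult_right_mono) auto
    ultimately show ?thesis using h pos by linarith
  next
    case False
    then have "l = ?n" by (simp add: l_def)
    moreover have "0 \<le> real l * ?s" using pos by simp
    ultimately show ?thesis using r \<delta>_split[of q] \<epsilon>_pos[of "Suc q"] by simp
  qed
  show ?thesis
  proof (rule that[of l a])
    fix z assume z: "z \<in> {a..<a + l}"
    show "I (w @ [Suc z]) \<subseteq> ball x r"
    proof
      fix y assume y: "y \<in> I (w @ [Suc z])"
      have "z \<le> z0 + h" "z0 \<le> z + h" using z x(1) l by (auto simp: a_def l_def min_def split: if_splits)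
      then have "real z * ?s \<le> (real z0 + real h) * ?s" "real z0 * ?s \<le> (real z + real h) * ?s"
        using pos by (intro mult_right_mono; simp)+
      then show "y \<in> ball x r"
        using y x(2) h(1) by (simp add: ball_eq_greaterThanLessThan mem_I lft_child rgt_child len algebra_simps)
    qed
  qed (use l rl x in \<open>auto simp: a_def\<close>)
qed

end

section \<open>Uniform vectors\<close>

lemma uniform_from_mono:
  assumes "uniform_from C s P" "C \<le> C'"
  shows "uniform_from C' s P"
proof -
  have "1 \<le> C" using assms(1) by (simp add: uniform_from_def)
  then have "inverse C' \<le> inverse C" using assms(2) by simp
  then show ?thesis using assms unfolding uniform_from_def by (meson order_trans)
qed

lemma uniform_fromI:
  assumes "1 \<le> C" "1 \<le> s" "s \<le> length P" and pos: "\<And>i. i < length P \<Longrightarrow> 0 < P ! i"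
    and le: "\<And>a b l. s \<le> l \<Longrightarrow> a + l \<le> length P \<Longrightarrow> b + l \<le> length P \<Longrightarrow> a \<le> b + l \<Longrightarrow> b \<le> a + l \<Longrightarrow>
        (\<Sum>m=a..<a+l. P ! m) \<le> C * (\<Sum>m=b..<b+l. P ! m)"
  shows "uniform_from C s P"
  unfolding uniform_from_def
proof (intro conjI allI impI ballI)
  fix x assume "x \<in> set P" then show "0 < x" using pos by (auto simp: in_set_conv_nth)
next
  fix i j l assume ijl: "s \<le> l \<and> l \<le> length P \<and> i \<le> j \<and> j \<le> i + l \<and> j + l \<le> length P"
  let ?A = "\<Sum>m=i..<i+l. P ! m" and ?B = "\<Sum>m=j..<j+l. P ! m"
  have "0 < ?A" "0 < ?B" using ijl assms(2) by (intro sum_pos pos; simp)+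
  moreover have "?A \<le> C * ?B" "?B \<le> C * ?A" using ijl by (auto intro: le)
  ultimately show "inverse C \<le> ?A / ?B" "?A / ?B \<le> C"
    using assms(1) by (simp_all add: pos_le_divide_eq pos_divide_le_eq inverse_eq_divide mult.commute)
qed (use assms in auto)

text \<open>
  The definition orders the two windows; as it bounds the quotient on both sides, the order does not matter.
\<close>

lemma uniform_from_window_step:
  assumes P: "uniform_from C s P" and "s \<le> l" "a + l \<le> length P" "b + l \<le> length P"
    and "a \<le> b + l" "b \<le> a + l"
  shows "(\<Sum>m=b..<b+l. P ! m) \<le> C * (\<Sum>m=a..<a+l. P ! m)"
proof -
  have C: "1 \<le> C" and s: "1 \<le> s" and pos: "\<And>i. i < length P \<Longrightarrow> 0 < P ! i"
    using P by (auto simp: uniform_from_def)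
  have "l \<le> length P" using assms by simp
  have S: "0 < (\<Sum>m=a..<a+l. P ! m)" "0 < (\<Sum>m=b..<b+l. P ! m)"
    using s assms(2-4) by (intro sum_pos pos; simp)+
  have "(\<Sum>m=a..<a+l. P ! m) / (\<Sum>m=b..<b+l. P ! m) \<ge> inverse C" if "a \<le> b"
    using P that assms(2-6) \<open>l \<le> length P\<close> unfolding uniform_from_def by blast
  moreover have "(\<Sum>m=b..<b+l. P ! m) / (\<Sum>m=a..<a+l. P ! m) \<le> C" if "b \<le> a"
    using P that assms(2-6) \<open>l \<le> length P\<close> unfolding uniform_from_def by blast
  ultimately show ?thesis using S C
    by (cases "a \<le> b") (simp_all add: pos_le_divide_eq pos_divide_le_eq inverse_eq_divide mult.commute)
qed

lemma uniform_from_window_shift: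
  assumes P: "uniform_from C s P" and "s \<le> l" "a + l \<le> length P" "b + l \<le> length P"
    and "a \<le> b + k * l" "b \<le> a + k * l"
  shows "(\<Sum>m=b..<b+l. P ! m) \<le> C ^ k * (\<Sum>m=a..<a+l. P ! m)"
  using assms(4-6)
proof (induction k arbitrary: b)
  case (Suc k)
  have C: "1 \<le> C" using P by (auto simp: uniform_from_def)
  \<comment> \<open>moving by at most \<open>l\<close> from \<open>b\<close> towards \<open>a\<close> keeps the windows touching\<close>
  define b' where "b' = (if b \<le> a then min a (b + l) else max a (b - l))"
  have "(\<Sum>m=b..<b+l. P ! m) \<le> C * (\<Sum>m=b'..<b'+l. P ! m)"
    by (rule uniform_from_window_step[OF P]) (use assms Suc.prems in \<open>auto simp: b'_def\<close>)
  also have "(\<Sum>m=b'..<b'+l. P ! m) \<le> C ^ k * (\<Sum>m=a..<a+l. P ! m)"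
    by (rule Suc.IH) (use assms Suc.prems in \<open>auto simp: b'_def\<close>)
  finally show ?case using C by (simp add: mult.assoc)
qed simp

lemma sum_UN_le:
  fixes f :: "'b \<Rightarrow> real"
  assumes "finite J" "\<And>e. e \<in> J \<Longrightarrow> finite (A e)" "\<And>i. i \<in> (\<Union>e\<in>J. A e) \<Longrightarrow> 0 \<le> f i"
  shows "sum f (\<Union>e\<in>J. A e) \<le> (\<Sum>e\<in>J. sum f (A e))"
  using assms
proof (induction J)
  case (insert e J)
  have "0 \<le> sum f (A e \<inter> (\<Union>e\<in>J. A e))" using insert.prems by (intro sum_nonneg) auto
  then have "sum f (A e \<union> (\<Union>e\<in>J. A e)) \<le> sum f (A e) + sum f (\<Union>e\<in>J. A e)"
    using insert by (subst sum_Un) auto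
  moreover have "sum f (\<Union>e\<in>J. A e) \<le> (\<Sum>e\<in>J. sum f (A e))"
    using insert.prems by (intro insert.IH) auto
  ultimately show ?case using insert.hyps by simp
qed simp

text \<open>
  The form in which uniformity is applied: the entries over any set of indices within \<open>k\<close> window lengths of
  a window are controlled by that window, since boundedly many shifted copies of it cover them.
\<close>

lemma uniform_from_cover:
  assumes P: "uniform_from C s P" and l: "s \<le> l" "a + l \<le> length P"
    and T: "\<And>z. z \<in> T \<Longrightarrow> z < length P \<and> a \<le> z + k * l \<and> z < a + Suc k * l"
  shows "(\<Sum>z\<in>T. P ! z) \<le> real (2 * Suc k) * C ^ k * (\<Sum>m=a..<a+l. P ! m)"
proof -
  let ?S = "\<lambda>b. \<Sum>m=b..<b+l. P ! m"
  have C: "1 \<le> C" and s: "1 \<le> s" and pos: "\<And>i. i < length P \<Longrightarrow> 0 < P ! i"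
    using P by (auto simp: uniform_from_def)
  \<comment> \<open>shifts of the window by multiples of \<open>l\<close>, the last one on each side pushed back into the list\<close>
  define up where "up e = min (a + e * l) (length P - l)" for e
  define down where "down e = a - e * l" for e
  have shift: "?S b \<le> C ^ k * ?S a" if "b + l \<le> length P" "a \<le> b + k * l" "b \<le> a + k * l" for b
    using uniform_from_window_shift[OF P l that] .
  have up: "?S (up e) \<le> C ^ k * ?S a" and down: "?S (down e) \<le> C ^ k * ?S a" if "e \<le> k" for e
  proof -
    have "e * l \<le> k * l" using that by simp
    then show "?S (up e) \<le> C ^ k * ?S a" "?S (down e) \<le> C ^ k * ?S a"
      unfolding up_def down_def using l by (intro shift; linarith)+
  qed
  have cov: "T \<subseteq> (\<Union>e\<in>{..k}. {up e..<up e + l}) \<union> (\<Union>e\<in>{..k}. {down e..<down e + l})"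
  proof
    fix z assume z: "z \<in> T"
    have l0: "0 < l" using s l by simp
    show "z \<in> (\<Union>e\<in>{..k}. {up e..<up e + l}) \<union> (\<Union>e\<in>{..k}. {down e..<down e + l})"
    proof (cases "a \<le> z")
      case True
      define e where "e = (z - a) div l"
      have 1: "z - a < Suc k * l" using T[OF z] True by linarith
      then have "e < Suc k" unfolding e_def using l0 by (simp add: less_mult_imp_div_less)
      moreover have "e * l \<le> z - a" "z - a < e * l + l"
        unfolding e_def using l0 dividend_less_div_times[of l "z - a"] by auto
      moreover have "z < length P" using T[OF z] by simp
      ultimately have "e \<le> k" "z \<in> {up e..<up e + l}"
        using True l(2) unfolding up_def atLeastLessThan_iff by linarith+
      then show ?thesis by (intro UnI1 UN_I[of e]) auto
    next
      case False
      define q where "q = (a - z - 1) div l"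
      have 1: "a - z - 1 < k * l" using T[OF z] False by linarith
      then have "q < k" unfolding q_def using l0 by (simp add: less_mult_imp_div_less)
      moreover have "q * l \<le> a - z - 1" "a - z - 1 < q * l + l"
        unfolding q_def using l0 dividend_less_div_times[of l "a - z - 1"] by auto
      then have "z \<in> {down (Suc q)..<down (Suc q) + l}"
        using False unfolding down_def mult_Suc atLeastLessThan_iff by linarith
      ultimately show ?thesis by (intro UnI2 UN_I[of "Suc q"]) auto
    qed
  qed
  let ?U = "\<Union>e\<in>{..k}. {up e..<up e + l}" and ?D = "\<Union>e\<in>{..k}. {down e..<down e + l}"
  have nn: "0 \<le> P ! i" if i: "i \<in> ?U \<union> ?D" for i
  proof (intro less_imp_le pos)
    have "up e + l \<le> length P" "down e + l \<le> length P" for e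
      unfolding up_def down_def using l by linarith+
    moreover obtain e where "i < up e + l \<or> i < down e + l" using i by auto
    ultimately show "i < length P" by (meson less_le_trans)
  qed
  have "(\<Sum>z\<in>T. P ! z) \<le> (\<Sum>z\<in>?U \<union> ?D. P ! z)"
    by (rule sum_mono2[OF _ cov]) (use nn in blast)+
  moreover have "(\<Sum>z\<in>?U \<union> ?D. P ! z) \<le> (\<Sum>z\<in>?U. P ! z) + (\<Sum>z\<in>?D. P ! z)"
  proof -
    have "0 \<le> (\<Sum>z\<in>?U \<inter> ?D. P ! z)" using nn by (intro sum_nonneg) blast
    then show ?thesis by (simp add: sum_Un)
  qed
  moreover have "(\<Sum>z\<in>?U. P ! z) \<le> real (Suc k) * (C ^ k * ?S a)"
  proof -
    have "(\<Sum>z\<in>?U. P ! z) \<le> (\<Sum>e\<le>k. ?S (up e))"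
      by (rule sum_UN_le) (use nn in auto)
    also have "\<dots> \<le> (\<Sum>e\<le>k. C ^ k * ?S a)"
      by (rule sum_mono) (use up in auto)
    finally show ?thesis by simp
  qed
  moreover have "(\<Sum>z\<in>?D. P ! z) \<le> real (Suc k) * (C ^ k * ?S a)"
  proof -
    have "(\<Sum>z\<in>?D. P ! z) \<le> (\<Sum>e\<le>k. ?S (down e))"
      by (rule sum_UN_le) (use nn in auto)
    also have "\<dots> \<le> (\<Sum>e\<le>k. C ^ k * ?S a)"
      by (rule sum_mono) (use down in auto)
    finally show ?thesis by simp
  qed
  ultimately show ?thesis by (simp add: algebra_simps)
qed

text \<open>
  Applied to the ratio vector of the empty word, the only one outside the criterion, this makes all levels
  alike.
\<close>

lemma uniform_vec_exists:
  assumes "P \<noteq> []" "\<And>i. i < length P \<Longrightarrow> 0 < P ! i"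
  shows "\<exists>C. uniform_vec C P"
proof -
  \<comment> \<open>\<open>T\<close> is a crude upper bound for the inverse of every entry\<close>
  define S where "S = (\<Sum>i<length P. P ! i)"
  define T where "T = (\<Sum>i<length P. inverse (P ! i))"
  have S: "0 \<le> S" unfolding S_def using assms(2) by (intro sum_nonneg) (simp add: less_imp_le)
  have T: "1 \<le> T * P ! i" if "i < length P" for i
  proof -
    have "inverse (P ! i) \<le> T" unfolding T_def
      using that assms(2) by (intro member_le_sum) (auto simp: less_imp_le)
    then show ?thesis using assms(2)[OF that] by (simp add: inverse_eq_divide pos_divide_le_eq)
  qed
  have "uniform_vec (max 1 (S * T)) P"
  proof (rule uniform_fromI)
    show "1 \<le> length P" using assms(1) by (cases P) auto
  next
    fix a b l :: nat
    assume l: "1 \<le> l" "a + l \<le> length P" "b + l \<le> length P"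
    have b: "b < length P" using l by simp
    have "P ! b \<le> (\<Sum>m=b..<b+l. P ! m)"
      using l assms(2) by (intro member_le_sum) (auto intro: less_imp_le)
    then have "1 \<le> T * (\<Sum>m=b..<b+l. P ! m)"
      using T[OF b] assms(2)[OF b]
      by (smt (verit) mult_left_mono mult_nonpos_nonneg)
    then have "S * 1 \<le> S * (T * (\<Sum>m=b..<b+l. P ! m))" using S by (intro mult_left_mono)
    moreover have "(\<Sum>m=a..<a+l. P ! m) \<le> S" unfolding S_def
      using l assms(2) by (intro sum_mono2) (auto intro: less_imp_le)
    moreover have "S * T * (\<Sum>m=b..<b+l. P ! m) \<le> max 1 (S * T) * (\<Sum>m=b..<b+l. P ! m)"
      using l assms(2) by (intro mult_right_mono sum_nonneg) (auto intro: less_imp_le)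
    ultimately show "(\<Sum>m=a..<a+l. P ! m) \<le> max 1 (S * T) * (\<Sum>m=b..<b+l. P ! m)"
      by (simp add: mult.assoc)
  qed (use assms in auto)
  then show ?thesis by blast
qed

section \<open>Measures on uniform Cantor sets\<close>

locale cantor_measure = uniform_cantor n c + prob_space \<mu>
  for n :: "nat \<Rightarrow> nat" and c :: "nat \<Rightarrow> real" and \<mu> :: "real measure" +
  assumes borel_on_E: "borel_measure_on (cantor_set n c) \<mu>"
    and mass_pos_all_words: "\<forall>w\<in>all_words n. word_mass n c \<mu> w > 0"
begin

abbreviation "mass \<equiv> word_mass n c \<mu>"
abbreviation "ratios \<equiv> ratio_vec n c \<mu>"

text \<open>
  Evaluating \<open>\<mu>\<close> on \<open>A \<inter> E\<close> allows intervals and balls of the real line as arguments.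
\<close>

definition M :: "real set \<Rightarrow> real" where "M A = measure \<mu> (A \<inter> E)"

lemma mass_eq_M: "mass w = M (I w)"
  by (simp add: word_mass_def M_def)

lemma M_sets: "A \<in> sets borel \<Longrightarrow> A \<inter> E \<in> events"
  using borel_on_E closed_E by (auto simp: borel_measure_on_def sets_restrict_space)

lemma M_nonneg: "0 \<le> M A" by (simp add: M_def)

lemma mass_nonneg: "0 \<le> mass w" by (simp add: mass_eq_M M_nonneg)

text \<open>
  Only the points of \<open>E\<close> count, so a set may be replaced by a smaller or larger one that differs in gaps.
\<close>

lemma M_mono: "A \<in> sets borel \<Longrightarrow> B \<in> sets borel \<Longrightarrow> A \<inter> E \<subseteq> B \<Longrightarrow> M A \<le> M B"
  unfolding M_def by (intro finite_measure_mono M_sets) auto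

lemma M_subadditive:
  assumes "A \<in> sets borel" "B \<in> sets borel" "D \<in> sets borel" "A \<inter> E \<subseteq> B \<union> D"
  shows "M A \<le> M B + M D"
proof -
  have "M A \<le> measure \<mu> ((B \<inter> E) \<union> (D \<inter> E))"
    unfolding M_def using assms by (intro finite_measure_mono sets.Un M_sets) auto
  also have "\<dots> \<le> M B + M D"
    unfolding M_def using assms by (intro measure_Un_le M_sets) auto
  finally show ?thesis .
qed

lemma M_null: "A \<inter> E = {} \<Longrightarrow> M A = 0" by (simp add: M_def)

lemma I_borel: "I w \<in> sets borel" by (simp add: I_eq)

lemma M_le_sum_mass:
  assumes "finite T" "A \<in> sets borel" "A \<inter> E \<subseteq> (\<Union>z\<in>T. I (f z))"
  shows "M A \<le> (\<Sum>z\<in>T. mass (f z))"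
proof -
  have "M A \<le> measure \<mu> (\<Union>z\<in>T. I (f z) \<inter> E)"
    unfolding M_def using assms by (intro finite_measure_mono sets.finite_UN M_sets I_borel) auto
  also have "\<dots> \<le> (\<Sum>z\<in>T. measure \<mu> (I (f z) \<inter> E))"
    using assms by (intro finite_measure_subadditive_finite) (auto intro: M_sets I_borel)
  finally show ?thesis by (simp add: mass_eq_M M_def)
qed

lemma sum_mass_le_M:
  assumes "finite T" "A \<in> sets borel" "\<And>z. z \<in> T \<Longrightarrow> f z \<in> words n k" "inj_on f T"
    "\<And>z. z \<in> T \<Longrightarrow> I (f z) \<inter> E \<subseteq> A"
  shows "(\<Sum>z\<in>T. mass (f z)) \<le> M A"
proof -
  have "disjoint_family_on (\<lambda>z. I (f z) \<inter> E) T"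
    unfolding disjoint_family_on_def using words_disjoint[OF assms(3) assms(3)] assms(4)
    by (metis (no_types, opaque_lifting) IntD1 disjoint_iff inj_onD)
  then have "(\<Sum>z\<in>T. measure \<mu> (I (f z) \<inter> E)) = measure \<mu> (\<Union>z\<in>T. I (f z) \<inter> E)"
    using assms(1) by (intro finite_measure_finite_Union[symmetric]) (auto intro: M_sets I_borel)
  also have "\<dots> \<le> M A"
    unfolding M_def using assms by (intro finite_measure_mono M_sets) auto
  finally show ?thesis by (simp add: mass_eq_M M_def)
qed

lemma M_UNIV: "M UNIV = 1"
proof -
  have "space \<mu> = E"
    using borel_on_E sets_eq_imp_space_eq[of \<mu> "restrict_space borel E"]
    by (simp add: borel_measure_on_def space_restrict_space)
  then show ?thesis using prob_space by (simp add: M_def)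
qed

lemma mass_pos: "w \<in> words n k \<Longrightarrow> 0 < mass w"
proof (cases "k = 0")
  case True
  have "M UNIV \<le> M (I [])" by (rule M_mono) (use E_bounds in \<open>auto simp: I_eq\<close>)
  moreover assume "w \<in> words n k"
  ultimately show ?thesis using True by (simp add: words_0[OF params] M_UNIV mass_eq_M)
next
  case False
  assume "w \<in> words n k"
  then show ?thesis using False mass_pos_all_words by (auto simp: all_words_def Suc_le_eq)
qed

lemma mass_split:
  assumes w: "w \<in> words n k"
  shows "mass w = (\<Sum>z<n (Suc k). mass (w @ [Suc z]))"
proof (rule antisym)
  have "I w \<inter> E \<subseteq> (\<Union>z\<in>{..<n (Suc k)}. I (w @ [Suc z]))"
  proof
    fix x assume "x \<in> I w \<inter> E"
    then obtain z where "z < n (Suc k)" "x \<in> I (w @ [Suc z])" using E_child[OF _ w] by blast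
    then show "x \<in> (\<Union>z\<in>{..<n (Suc k)}. I (w @ [Suc z]))" by blast
  qed
  then show "mass w \<le> (\<Sum>z<n (Suc k). mass (w @ [Suc z]))"
    unfolding mass_eq_M[of w] by (intro M_le_sum_mass I_borel finite_lessThan)
  have "I (w @ [Suc z]) \<inter> E \<subseteq> I w" if "z < n (Suc k)" for z
    using child_subset[OF w, of "Suc z"] that by auto
  then show "(\<Sum>z<n (Suc k). mass (w @ [Suc z])) \<le> mass w"
    unfolding mass_eq_M[of w]
    by (intro sum_mass_le_M[where k = "Suc k"] words_child[OF w])
       (auto simp: inj_on_def I_borel simp del: Int_subset_iff)
qed

lemma M_run_le:
  assumes w: "w \<in> words n k" and al: "a + l \<le> n (Suc k)"
  shows "M {lft w + real a * \<sigma> (Suc k) .. lft w + real (a + l) * \<sigma> (Suc k) - \<epsilon> (Suc k)}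
    \<le> (\<Sum>z=a..<a+l. mass (w @ [Suc z]))"
proof (rule M_le_sum_mass)
  have len: "length w = k" using w words_length by auto
  have \<sigma>0: "0 < \<sigma> (Suc k)" "\<delta> (Suc k) < \<sigma> (Suc k)" "0 < \<epsilon> (Suc k)" using \<sigma>_bounds \<epsilon>_pos by auto
  show "{lft w + real a * \<sigma> (Suc k) .. lft w + real (a + l) * \<sigma> (Suc k) - \<epsilon> (Suc k)} \<inter> E
      \<subseteq> (\<Union>z\<in>{a..<a+l}. I (w @ [Suc z]))"
  proof
    fix x assume x: "x \<in> {lft w + real a * \<sigma> (Suc k) .. lft w + real (a + l) * \<sigma> (Suc k) - \<epsilon> (Suc k)} \<inter> E"
    have "real (a + l) * \<sigma> (Suc k) \<le> real (n (Suc k)) * \<sigma> (Suc k)" "0 \<le> real a * \<sigma> (Suc k)"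
      using al \<sigma>0 by (auto intro!: mult_right_mono)
    then have "x \<in> I w" using x rgt_eq[of w] by (auto simp: mem_I len)
    then obtain z where z: "x \<in> I (w @ [Suc z])" using E_child[OF _ w] x by blast
    have "real a * \<sigma> (Suc k) < real (Suc z) * \<sigma> (Suc k)"
      using x z \<sigma>0 by (auto simp: mem_I rgt_child len algebra_simps)
    moreover have "real z * \<sigma> (Suc k) < real (a + l) * \<sigma> (Suc k)"
    proof -
      have "lft w + real z * \<sigma> (Suc k) \<le> x" using z by (simp add: mem_I lft_child len)
      moreover have "x \<le> lft w + real (a + l) * \<sigma> (Suc k) - \<epsilon> (Suc k)" using x by simp
      ultimately show ?thesis using \<sigma>0 by linarith
    qed
    ultimately have "a \<le> z" "z < a + l" using \<sigma>0 by auto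
    then show "x \<in> (\<Union>z\<in>{a..<a+l}. I (w @ [Suc z]))" using z by auto
  qed
qed auto

text \<open>
  As \<open>\<mu>\<close> is finite, the extended nonnegative measure values can be replaced by real numbers.
\<close>

lemma doubling_iff:
  "doubling_measure_on E \<mu> \<longleftrightarrow>
    (\<exists>D\<ge>1. \<forall>x\<in>E. \<forall>r>0. 0 < M (ball x (2 * r)) \<and> M (ball x (2 * r)) \<le> D * M (ball x r))"
proof -
  have "(0 < emeasure \<mu> (ball x (2 * r) \<inter> E) \<and>
        emeasure \<mu> (ball x (2 * r) \<inter> E) \<le> ennreal D * emeasure \<mu> (ball x r \<inter> E) \<and>
        ennreal D * emeasure \<mu> (ball x r \<inter> E) < \<infinity>) \<longleftrightarrow>
      0 < M (ball x (2 * r)) \<and> M (ball x (2 * r)) \<le> D * M (ball x r)" if "1 \<le> D" for D x r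
    using that by (simp add: emeasure_eq_measure M_def ennreal_mult[symmetric])
  then show ?thesis using borel_on_E unfolding doubling_measure_on_def by (auto cong: conj_cong)
qed

lemma length_ratios [simp]: "length (ratios w) = n (Suc (length w))"
  by (simp add: ratio_vec_def)

lemma nth_ratios: "z < n (Suc (length w)) \<Longrightarrow> ratios w ! z = mass (w @ [Suc z]) / mass w"
  by (simp add: ratio_vec_def word_ratio_def del: upt_Suc)

lemma nth_ratios_append:
  assumes "v \<in> words n k" "w \<in> words n k" "z < 2 * n (Suc k)"
  shows "(ratios v @ ratios w) ! z = mass (cell v w z) / (if z < n (Suc k) then mass v else mass w)"
proof (cases "z < n (Suc k)")
  case False
  then have "z - n (Suc k) < n (Suc k)" using assms(3) by simp
  then show ?thesis using False assms(1,2)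
    by (simp add: nth_append cell_def nth_ratios words_length Let_def)
qed (use assms in \<open>simp add: nth_append cell_def nth_ratios words_length\<close>)

lemma word_ratio_snoc: "word_ratio n c \<mu> (w @ [i]) = mass (w @ [i]) / mass w"
  by (simp add: word_ratio_def)

text \<open>
  The products of ratios in the criterion telescope, which turns the product inequalities into
  comparisons of masses.
\<close>

lemma prod_ratio_ext:
  assumes "v \<in> words n k"
  shows "(\<Prod>j=1..t. word_ratio n c \<mu> (max_word_ext n v j)) = mass (max_word_ext n v t) / mass v"
    "(\<Prod>j=1..t. word_ratio n c \<mu> (min_word_ext v j)) = mass (min_word_ext v t) / mass v"
proof (induction t)
  case 0
  { case 1 then show ?case using mass_pos[OF assms] by simp }
  { case 2 then show ?case using mass_pos[OF assms] by simp }
next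
  case (Suc t)
  { case 1 then show ?case using Suc mass_pos[OF word_ext_words(1)[OF assms, of t]]
      by (simp add: max_word_ext_Suc word_ratio_snoc) }
  { case 2 then show ?case using Suc mass_pos[OF word_ext_words(2)[OF assms, of t]]
      by (simp add: min_word_ext_Suc word_ratio_snoc) }
qed

text \<open>
  The criterion for a fixed constant \<open>C\<close>.
\<close>

definition adapted :: "real \<Rightarrow> bool" where
  "adapted C \<longleftrightarrow>
      (\<forall>w\<in>all_words n. uniform_vec C (ratio_vec n c \<mu> w)) \<and>
      (\<forall>k\<in>large_gap_levels n c.
        (\<forall>w\<in>words n (k - 1). \<forall>i t.
          1 \<le> i \<and> i < n k \<and> 1 \<le> t \<and> t < depth_idx n c k \<longrightarrow>
            uniform_vec C
              (ratio_vec n c \<mu> (max_word_ext n (w @ [i]) (t - 1)) @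
               ratio_vec n c \<mu> (min_word_ext (w @ [i + 1]) (t - 1))) \<and>
            inverse C * (\<Prod>j=1..t. word_ratio n c \<mu> (max_word_ext n (w @ [i]) j))
              \<le> (\<Prod>j=1..t. word_ratio n c \<mu> (min_word_ext (w @ [i + 1]) j)) \<and>
            (\<Prod>j=1..t. word_ratio n c \<mu> (min_word_ext (w @ [i + 1]) j))
              \<le> C * (\<Prod>j=1..t. word_ratio n c \<mu> (max_word_ext n (w @ [i]) j))) \<and>
        (\<forall>w\<in>words n (k - 1). \<forall>i.
          1 \<le> i \<and> i < n k \<longrightarrow>
            uniform_from C (block_idx n c k)
              (ratio_vec n c \<mu> (max_word_ext n (w @ [i]) (depth_idx n c k - 1)) @
               ratio_vec n c \<mu> (min_word_ext (w @ [i + 1]) (depth_idx n c k - 1)))))"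

lemma adapted_mono:
  assumes "adapted C" "1 \<le> C" "C \<le> C'"
  shows "adapted C'"
proof -
  have P: "0 \<le> (\<Prod>j=1..t. word_ratio n c \<mu> (f j))" for t and f :: "nat \<Rightarrow> nat list"
    by (intro prod_nonneg) (simp add: word_ratio_def mass_nonneg)
  have "inverse C' * x \<le> inverse C * x" "C * x \<le> C' * x" if "0 \<le> x" for x
    using assms that by (intro mult_right_mono; simp)+
  note this[OF P]
  then show ?thesis
    using assms(1) uniform_from_mono[OF _ assms(3)] unfolding adapted_def by (meson order_trans)
qed

end

section \<open>Doubling implies uniformity\<close>

locale doubling_cantor_measure = cantor_measure n c \<mu> for n c \<mu> +
  fixes D :: real
  assumes D_ge_1: "1 \<le> D"
    and doubling: "x \<in> cantor_set n c \<Longrightarrow> 0 < r \<Longrightarrow> M (ball x (2 * r)) \<le> D * M (ball x r)"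
begin

lemma D_power_mono: "i \<le> j \<Longrightarrow> 0 \<le> a \<Longrightarrow> D ^ i * a \<le> D ^ j * a"
  using D_ge_1 by (intro mult_right_mono power_increasing) auto

lemma doubling_iterate:
  assumes "y \<in> E" "0 < r" "S \<in> sets borel" "A \<in> sets borel"
    and "S \<inter> E \<subseteq> ball y (2 ^ p * r)" "ball y r \<inter> E \<subseteq> A"
  shows "M S \<le> D ^ p * M A"
proof -
  have "M (ball y (2 ^ p * r)) \<le> D ^ p * M (ball y r)"
  proof (induction p)
    case (Suc p)
    have "M (ball y (2 ^ Suc p * r)) \<le> D * M (ball y (2 ^ p * r))"
      using doubling[of y "2 ^ p * r"] assms(1,2) by (simp add: mult.assoc)
    also have "\<dots> \<le> D * (D ^ p * M (ball y r))"
      using Suc D_ge_1 by (intro mult_left_mono) auto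
    finally show ?case by (simp add: mult.assoc)
  qed simp
  moreover have "M S \<le> M (ball y (2 ^ p * r))" using assms by (intro M_mono) auto
  moreover have "D ^ p * M (ball y r) \<le> D ^ p * M A"
    using assms D_ge_1 by (intro mult_left_mono M_mono) auto
  ultimately show ?thesis by linarith
qed

text \<open>
  Two consecutive siblings that are very short compared with the gap between them form a run without a
  point of \<open>E\<close> deep inside it, and doubling has to be exploited at another scale.  Let \<open>I v\<close> be such a
  sibling.  Within half of that gap, the rest \<open>Z\<close> of \<open>E\<close> has diameter at most the length \<open>\<delta>\<close> of
  \<open>I v\<close>: two points of \<open>Z\<close> in different components of the previous level would, together with \<open>I v\<close>,
  contradict \<open>three_words_spread\<close>, and two points in the same one lie in the same child.  So near \<open>I v\<close>
  there is at most one other small piece.  If it is close, a ball of radius \<open>8 \<delta>\<close> contains both; if it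
  is at distance \<open>\<rho> > 4 \<delta>\<close>, the ball of radius \<open>\<rho> / 2\<close> sees only \<open>I v\<close> and that of radius
  \<open>2 \<rho>\<close> both.
\<close>

lemma thin_component:
  assumes w: "w \<in> words n k" and z: "z < n (Suc k)" and thin: "32 * \<delta> (Suc k) < \<epsilon> (Suc k)"
  defines "v \<equiv> w @ [Suc z]"
  shows "M (ball (lft v) (\<epsilon> (Suc k) / 2)) \<le> D ^ 3 * mass v"
proof -
  let ?d = "\<delta> (Suc k)" and ?e = "\<epsilon> (Suc k)"
  have v: "v \<in> words n (Suc k)" using words_child[OF w z] by (simp add: v_def)
  have len: "length w = k" "length v = Suc k" using w v words_length by auto
  have d0: "0 < ?d" by (rule \<delta>_pos)
  have \<sigma>0: "0 < \<sigma> (Suc k)" by (rule \<sigma>_bounds) simp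
  have rgt_v: "rgt v = lft v + ?d" by (simp add: rgt_def len)
  have lv: "lft v \<in> E" "lft v \<in> I v" "rgt v \<in> E" using endpoint_in_E[OF v] rgt_v d0 by (auto simp: mem_I)
  have lvw: "lft v \<in> I w" using child_subset[OF w, of "Suc z"] z lv by (auto simp: v_def)
  have same_child: "i = j"
    if "x \<in> I (u @ [Suc i])" "y \<in> I (u @ [Suc j])" "u \<in> words n k" "\<bar>x - y\<bar> < ?e" for x y u i j
  proof (rule ccontr)
    have lu: "length u = k" using that(3) words_length by auto
    assume "i \<noteq> j"
    moreover have "?e \<le> y - x" if "i < j"
      using children_separated[OF that \<open>x \<in> I (u @ [Suc i])\<close> \<open>y \<in> I (u @ [Suc j])\<close> lu] \<sigma>0
      by (smt (verit) mult_nonneg_nonneg of_nat_0_le_iff)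
    moreover have "?e \<le> x - y" if "j < i"
      using children_separated[OF that \<open>y \<in> I (u @ [Suc j])\<close> \<open>x \<in> I (u @ [Suc i])\<close> lu] \<sigma>0
      by (smt (verit) mult_nonneg_nonneg of_nat_0_le_iff)
    ultimately show False using that(4) by linarith
  qed
  \<comment> \<open>the foreign part of \<open>E\<close> near \<open>I v\<close>; siblings of \<open>v\<close> are too far away to contribute\<close>
  define Z where "Z = {x \<in> E. x \<notin> I v \<and> x \<in> ball (lft v) (?e / 2)}"
  have Z_out: "x \<notin> I w" if "x \<in> Z" for x
  proof
    assume "x \<in> I w"
    moreover have "x \<in> E" using that by (simp add: Z_def)
    ultimately obtain i where "i < n (Suc k)" "x \<in> I (w @ [Suc i])"
      using E_child[OF _ w] by blast
    then show False using same_child[of x w i "lft v" z] that lv(2) w d0 thin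
      by (auto simp: Z_def v_def ball_eq_greaterThanLessThan abs_less_iff)
  qed
  have Z_diam: "\<bar>x - y\<bar> \<le> ?d" if "x \<in> Z" "y \<in> Z" for x y
  proof -
    have E: "x \<in> E" "y \<in> E" using that by (auto simp: Z_def)
    obtain u where u: "u \<in> words n k" "x \<in> I u" using E_word[OF E(1)] by blast
    obtain u' where u': "u' \<in> words n k" "y \<in> I u'" using E_word[OF E(2)] by blast
    have "u \<noteq> w" "u' \<noteq> w" using Z_out that u u' by auto
    have xl: "\<bar>x - lft v\<bar> < ?e / 2" "\<bar>y - lft v\<bar> < ?e / 2"
      using that by (auto simp: Z_def dist_real_def abs_minus_commute)
    then have xy: "\<bar>x - y\<bar> < ?e" by linarith
    have "u = u'"
    proof (rule ccontr)
      assume uu': "u \<noteq> u'"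
      have "\<delta> k < ?e"
        using three_words_spread[OF u(1) u'(1) w uu' \<open>u' \<noteq> w\<close> \<open>u \<noteq> w\<close> u(2) u'(2) lvw]
      proof (elim disjE)
        assume "\<delta> k < \<bar>x - y\<bar>" then show ?thesis using xy by linarith
      next
        assume "\<delta> k < \<bar>y - lft v\<bar>" then show ?thesis using xl(2) d0 thin by linarith
      next
        assume "\<delta> k < \<bar>x - lft v\<bar>" then show ?thesis using xl(1) d0 thin by linarith
      qed
      moreover have "2 * \<sigma> (Suc k) \<le> real (n (Suc k)) * \<sigma> (Suc k)"
        using n_ge_2[of "Suc k"] \<sigma>0 by (intro mult_right_mono) auto
      ultimately show False using \<delta>_split[of k] d0 by (simp add: period_def)
    qed
    obtain i where i: "x \<in> I (u @ [Suc i])" using E_child[OF E(1) u] by blast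
    obtain j where j: "y \<in> I (u @ [Suc j])" using E_child[OF E(2) u'] \<open>u = u'\<close> by blast
    have "i = j" by (rule same_child[OF i j u(1) xy])
    then show ?thesis using i j by (auto simp: mem_I rgt_child lft_child words_length[OF u(1)] abs_le_iff)
  qed
  \<comment> \<open>\<open>Z\<close> is too short to lie on both sides of \<open>I v\<close>, so one endpoint of \<open>I v\<close> is isolated from outside\<close>
  obtain y where y: "y \<in> E" "y \<in> I v" "ball y ?d \<inter> E \<subseteq> I v"
  proof (cases "ball (lft v) ?d \<inter> E \<subseteq> I v")
    case False
    then obtain x where x': "x \<in> ball (lft v) ?d" "x \<in> E" "x \<notin> I v" by blast
    then have x: "x < lft v" by (auto simp: mem_I rgt_v ball_eq_greaterThanLessThan)
    with x' have "x \<in> Z" using thin d0 by (simp add: Z_def ball_eq_greaterThanLessThan)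
    note x = this x
    have "ball (rgt v) ?d \<inter> E \<subseteq> I v"
    proof
      fix x' assume x': "x' \<in> ball (rgt v) ?d \<inter> E"
      show "x' \<in> I v"
      proof (rule ccontr)
        assume "x' \<notin> I v"
        then have "x' \<in> Z" "rgt v < x'"
          using x' thin d0 by (auto simp: Z_def mem_I rgt_v ball_eq_greaterThanLessThan abs_less_iff)
        then show False using Z_diam[OF \<open>x' \<in> Z\<close> x(1)] x(2) rgt_v by linarith
      qed
    qed
    then show ?thesis using that[of "rgt v"] lv d0 by (auto simp: mem_I rgt_v)
  qed (use that lv in blast)
  have mass_v: "mass v = M (I v)" by (rule mass_eq_M)
  show ?thesis
  proof (cases "Z = {}")
    case True
    have "M (ball (lft v) (?e / 2)) \<le> D ^ 0 * mass v"
      unfolding mass_v using True by (simp, intro M_mono) (auto simp: Z_def I_borel ball_eq_greaterThanLessThan abs_less_iff)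
    also have "\<dots> \<le> D ^ 3 * mass v" using mass_pos[OF v] by (intro D_power_mono) auto
    finally show ?thesis .
  next
    case False
    then obtain e0 where e0: "e0 \<in> Z" by blast
    define \<rho> where "\<rho> = \<bar>e0 - lft v\<bar>"
    have near: "x \<in> I v \<or> (e0 - ?d \<le> x \<and> x \<le> e0 + ?d)" if "x \<in> E" "x \<in> ball (lft v) (?e / 2)" for x
      using Z_diam[OF _ e0, of x] that by (auto simp: Z_def abs_le_iff)
    have \<rho>_cases: "\<rho> = e0 - lft v \<or> \<rho> = lft v - e0" "0 \<le> \<rho>" by (auto simp: \<rho>_def)
    have \<rho>: "\<rho> < ?e / 2" using e0 by (auto simp: Z_def \<rho>_def dist_real_def abs_minus_commute)
    show ?thesis
    proof (cases "\<rho> \<le> 4 * ?d")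
      case True
      show ?thesis unfolding mass_v
      proof (rule doubling_iterate[OF y(1) d0 _ _ _ y(3)])
        show "ball (lft v) (?e / 2) \<inter> E \<subseteq> ball y (2 ^ 3 * ?d)"
        proof
          fix x assume x: "x \<in> ball (lft v) (?e / 2) \<inter> E"
          then have "x \<in> I v \<or> (e0 - ?d \<le> x \<and> x \<le> e0 + ?d)" by (intro near) (auto simp: ball_eq_greaterThanLessThan abs_less_iff)
          then show "x \<in> ball y (2 ^ 3 * ?d)"
            using True \<rho>_cases y(2) d0 by (auto simp: mem_I rgt_v ball_eq_greaterThanLessThan abs_less_iff)
        qed
      qed (auto simp: I_borel)
    next
      case far: False
      have "M (ball (lft v) (?e / 2)) \<le> D ^ 2 * mass v" unfolding mass_v
      proof (rule doubling_iterate[OF lv(1), where r = "\<rho> / 2"])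
        show "ball (lft v) (?e / 2) \<inter> E \<subseteq> ball (lft v) (2 ^ 2 * (\<rho> / 2))"
        proof
          fix x assume x: "x \<in> ball (lft v) (?e / 2) \<inter> E"
          then have "x \<in> I v \<or> (e0 - ?d \<le> x \<and> x \<le> e0 + ?d)" by (intro near) (auto simp: ball_eq_greaterThanLessThan abs_less_iff)
          then show "x \<in> ball (lft v) (2 ^ 2 * (\<rho> / 2))"
            using far \<rho>_cases d0 by (auto simp: mem_I rgt_v ball_eq_greaterThanLessThan abs_less_iff)
        qed
        show "ball (lft v) (\<rho> / 2) \<inter> E \<subseteq> I v"
        proof
          fix x assume x: "x \<in> ball (lft v) (\<rho> / 2) \<inter> E"
          then have "x \<in> I v \<or> (e0 - ?d \<le> x \<and> x \<le> e0 + ?d)"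
            using \<rho> by (intro near) (auto simp: ball_eq_greaterThanLessThan abs_less_iff)
          moreover have "4 * ?d < \<rho>" "lft v - \<rho> / 2 < x" "x < lft v + \<rho> / 2"
            using x far by (simp_all add: ball_eq_greaterThanLessThan)
          then have "\<not> (e0 - ?d \<le> x \<and> x \<le> e0 + ?d)" using \<rho>_cases(1) d0 by linarith
          ultimately show "x \<in> I v" by blast
        qed
      qed (use far d0 in \<open>auto simp: I_borel\<close>)
      also have "\<dots> \<le> D ^ 3 * mass v" using mass_pos[OF v] by (intro D_power_mono) auto
      finally show ?thesis .
    qed
  qed
qed

text \<open>
  A run of at least two siblings carries a fixed share of the mass around it: doubling is applied at a point
  of \<open>E\<close> deep inside the run if there is one.  There is none only if the run consists of two components
  much shorter than the gap between them, and then \<open>thin_component\<close> for the first of them suffices.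
\<close>

lemma long_run_ball:
  assumes w: "w \<in> words n k" and l: "2 \<le> l" and al: "a + l \<le> n (Suc k)"
  shows "M (ball (lft w + real a * \<sigma> (Suc k)) (16 * real l * \<sigma> (Suc k)))
    \<le> D ^ 11 * (\<Sum>z=a..<a+l. mass (w @ [Suc z]))" (is "M ?B \<le> _ * ?S")
proof -
  let ?d = "\<delta> (Suc k)" and ?e = "\<epsilon> (Suc k)" and ?s = "\<sigma> (Suc k)"
  let ?A = "{lft w + real a * ?s .. lft w + real (a + l) * ?s - ?e}"
  have len: "length w = k" using w words_length by auto
  have pos: "0 < ?d" "0 < ?e" "0 < ?s" "?s = ?d + ?e"
    using \<sigma>_bounds \<epsilon>_pos \<delta>_pos by (auto simp: period_def)
  have S0: "0 \<le> ?S" by (simp add: sum_nonneg mass_nonneg)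
  have fin: "M ?B \<le> D ^ 11 * ?S" if "M ?B \<le> D ^ p * M ?A" "p \<le> 11" for p
  proof -
    have "D ^ p * M ?A \<le> D ^ p * ?S" using M_run_le[OF w al] D_ge_1 by (intro mult_left_mono) auto
    also have "\<dots> \<le> D ^ 11 * ?S" using S0 that(2) by (rule D_power_mono[rotated])
    finally show ?thesis using that(1) by linarith
  qed
  consider "3 \<le> l" | "l = 2" "?e \<le> 32 * ?d" | "l = 2" "32 * ?d < ?e" using l by linarith
  then show ?thesis
  proof cases
    case 1
    \<comment> \<open>the left endpoint of a middle child is at depth at least \<open>l \<sigma> / 4\<close> in the run\<close>
    define h where "h = l div 2"
    define p where "p = lft w + real a * ?s"
    define L where "L = real l * ?s"
    define H where "H = real h * ?s"
    have h: "l \<le> 4 * h" "4 * h + 4 \<le> 3 * l" "h < l" using 1 unfolding h_def by presburger+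
    have "real l \<le> real (4 * h)" "real (4 * h + 4) \<le> real (3 * l)" "real h \<le> real l" "0 < real l"
      using h by (simp_all only: of_nat_le_iff of_nat_0_less_iff)
    then have "real l * ?s \<le> real (4 * h) * ?s" "real (4 * h + 4) * ?s \<le> real (3 * l) * ?s"
      "real h * ?s \<le> real l * ?s" "0 < real l * ?s"
      using pos(3) by (auto intro!: mult_right_mono simp del: of_nat_add of_nat_mult)
    then have LH: "L \<le> 4 * H" "4 * H + 4 * ?s \<le> 3 * L" "H \<le> L" "0 < L"
      by (auto simp: L_def H_def algebra_simps)
    have A: "?A = {p .. p + L - ?e}" and B: "?B = ball p (16 * L)"
      by (simp_all add: p_def L_def algebra_simps)
    have "w @ [Suc (a + h)] \<in> words n (Suc k)" using h(3) al by (intro words_child[OF w]) linarith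
    then have "lft (w @ [Suc (a + h)]) \<in> E" by (rule endpoint_in_E)
    then have y: "p + H \<in> E" by (simp add: lft_child len p_def H_def algebra_simps)
    have "M ?B \<le> D ^ 7 * M ?A" unfolding A B
    proof (rule doubling_iterate[OF y, where r = "L / 4"])
      show "ball p (16 * L) \<inter> E \<subseteq> ball (p + H) (2 ^ 7 * (L / 4))"
        using LH pos(1,2,3) by (auto simp: ball_eq_greaterThanLessThan)
      show "ball (p + H) (L / 4) \<inter> E \<subseteq> {p .. p + L - ?e}"
        using LH pos(1,2,3) \<sigma>_bounds(2)[of "Suc k"] by (auto simp: ball_eq_greaterThanLessThan)
    qed (use LH in auto)
    then show ?thesis by (rule fin) simp
  next
    case 2
    \<comment> \<open>the right endpoint of the first child is at depth \<open>\<delta>\<close>, which is comparable to \<open>\<sigma>\<close>\<close>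
    define y where "y = rgt (w @ [Suc a])"
    have "w @ [Suc a] \<in> words n (Suc k)" using al 2 by (intro words_child[OF w]) linarith
    then have y: "y \<in> E" unfolding y_def by (rule endpoint_in_E)
    have y_eq: "y = lft w + real a * ?s + ?d" by (simp add: y_def rgt_child len)
    have "M ?B \<le> D ^ 11 * M ?A"
    proof (rule doubling_iterate[OF y, where r = ?d])
      show "?B \<inter> E \<subseteq> ball y (2 ^ 11 * ?d)"
        using 2 pos by (auto simp: ball_eq_greaterThanLessThan y_eq)
      show "ball y ?d \<inter> E \<subseteq> ?A"
        using 2 pos by (auto simp: ball_eq_greaterThanLessThan y_eq algebra_simps)
    qed (use pos in auto)
    then show ?thesis by (rule fin) simp
  next
    case 3
    define v where "v = w @ [Suc a]"
    have a: "a < n (Suc k)" using al 3 by simp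
    have v: "v \<in> words n (Suc k)" using words_child[OF w a] by (simp add: v_def)
    have lv: "lft v = lft w + real a * ?s" by (simp add: v_def lft_child len)
    have "M ?B \<le> D ^ 7 * M (ball (lft v) (?e / 2))"
    proof (rule doubling_iterate[OF endpoint_in_E(1)[OF v], where r = "?e / 2"])
      show "?B \<inter> E \<subseteq> ball (lft v) (2 ^ 7 * (?e / 2))"
        using 3 pos by (auto simp: ball_eq_greaterThanLessThan lv)
    qed (use pos in auto)
    also have "\<dots> \<le> D ^ 7 * (D ^ 3 * mass v)"
      using thin_component[OF w a 3(2)] D_ge_1 by (intro mult_left_mono) (auto simp: v_def)
    also have "\<dots> = D ^ 10 * mass v" by (simp flip: power_add mult.assoc)
    also have "\<dots> \<le> D ^ 10 * ?S"
    proof (rule mult_left_mono)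
      show "mass v \<le> ?S" unfolding v_def
        using 3 by (intro member_le_sum[of a "{a..<a+l}" "\<lambda>z. mass (w @ [Suc z])"]) (auto intro: mass_nonneg)
    qed (use D_ge_1 in auto)
    also have "\<dots> \<le> D ^ 11 * ?S" using S0 by (intro D_power_mono) auto
    finally show ?thesis .
  qed
qed

text \<open>
  A single component either is thin, or its sibling gap is relatively short and it can be treated as the run
  of its children, of which there are at least two.  The factor \<open>16\<close> leaves room for all the
  windows that touch a window of up to twice the length of the run.
\<close>

lemma run_ball:
  assumes w: "w \<in> words n k" and l: "1 \<le> l" and al: "a + l \<le> n (Suc k)"
  shows "M (ball (lft w + real a * \<sigma> (Suc k)) (16 * real l * \<sigma> (Suc k)))
    \<le> D ^ 17 * (\<Sum>z=a..<a+l. mass (w @ [Suc z]))" (is "M ?B \<le> _ * ?S")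
proof -
  let ?d = "\<delta> (Suc k)" and ?e = "\<epsilon> (Suc k)" and ?s = "\<sigma> (Suc k)"
  have len: "length w = k" using w words_length by auto
  have pos: "0 < ?d" "0 < ?e" "0 < ?s" "?s = ?d + ?e"
    using \<sigma>_bounds \<epsilon>_pos \<delta>_pos by (auto simp: period_def)
  have S0: "0 \<le> ?S" by (simp add: sum_nonneg mass_nonneg)
  have "D ^ p * ?S \<le> D ^ 17 * ?S" if "p \<le> 17" for p using that S0 by (rule D_power_mono)
  note up = order_trans[OF _ this]
  define v where "v = w @ [Suc a]"
  have a: "a < n (Suc k)" using al l by simp
  have v: "v \<in> words n (Suc k)" using words_child[OF w a] by (simp add: v_def)
  have lv: "lft v = lft w + real a * ?s" by (simp add: v_def lft_child len)
  consider "2 \<le> l" | "l = 1" "?e \<le> 32 * ?d" | "l = 1" "32 * ?d < ?e" using l by linarith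
  then show ?thesis
  proof cases
    case 1
    show ?thesis using long_run_ball[OF w 1 al] by (rule up) simp
  next
    case 2
    let ?n = "n (Suc (Suc k))" and ?s' = "\<sigma> (Suc (Suc k))"
    \<comment> \<open>the component itself is the run of all its children, and there are at least two of them\<close>
    have d: "?d \<le> real ?n * ?s'" using \<delta>_split[of "Suc k"] \<epsilon>_pos[of "Suc (Suc k)"] by simp
    have "M ?B \<le> D ^ 6 * M (ball (lft v) (16 * real ?n * ?s'))"
    proof (rule doubling_iterate[OF endpoint_in_E(1)[OF v], where r = "16 * real ?n * ?s'"])
      show "?B \<inter> E \<subseteq> ball (lft v) (2 ^ 6 * (16 * real ?n * ?s'))"
        using 2 pos d by (auto simp: ball_eq_greaterThanLessThan lv)
    qed (use pos d in auto)
    also have "\<dots> \<le> D ^ 6 * (D ^ 11 * mass v)"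
      using long_run_ball[OF v, of ?n 0] n_ge_2[of "Suc (Suc k)"] D_ge_1 mass_split[OF v]
      by (intro mult_left_mono) (auto simp: atLeast0LessThan)
    also have "\<dots> = D ^ 17 * ?S" using 2 by (simp add: v_def flip: power_add mult.assoc)
    finally show ?thesis .
  next
    case 3
    have "M ?B \<le> D ^ 7 * M (ball (lft v) (?e / 2))"
    proof (rule doubling_iterate[OF endpoint_in_E(1)[OF v], where r = "?e / 2"])
      show "?B \<inter> E \<subseteq> ball (lft v) (2 ^ 7 * (?e / 2))"
        using 3 pos by (auto simp: ball_eq_greaterThanLessThan lv)
    qed (use pos in auto)
    also have "\<dots> \<le> D ^ 7 * (D ^ 3 * mass v)"
      using thin_component[OF w a 3(2)] D_ge_1 by (intro mult_left_mono) (auto simp: v_def)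
    also have "\<dots> = D ^ 10 * ?S" using 3 by (simp add: v_def flip: power_add mult.assoc)
    finally show ?thesis by (rule up) simp
  qed
qed

text \<open>
  A neighbour at distance at most \<open>\<delta> k\<close> lies in the ball that \<open>run_ball\<close> provides for the run of all
  children.
\<close>

lemma neighbour_mass:
  assumes v: "v \<in> words n k" and w: "w \<in> words n k" and g: "lft w = rgt v + \<gamma>" "0 \<le> \<gamma>" "\<gamma> \<le> \<delta> k"
  shows "mass v \<le> D ^ 17 * mass w" "mass w \<le> D ^ 17 * mass v"
proof -
  let ?n = "n (Suc k)"
  have d: "\<delta> k \<le> real ?n * \<sigma> (Suc k)" using \<delta>_split[of k] \<epsilon>_pos[of "Suc k"] by simp
  have ball: "M (ball (lft u) (16 * real ?n * \<sigma> (Suc k))) \<le> D ^ 17 * mass u" if "u \<in> words n k" for u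
    using run_ball[OF that, of ?n 0] n_ge_2[of "Suc k"] mass_split[OF that] by (auto simp: atLeast0LessThan)
  have r: "rgt v = lft v + \<delta> k" "rgt w = lft w + \<delta> k" using v w by (auto simp: rgt_def words_length)
  have "mass v \<le> M (ball (lft w) (16 * real ?n * \<sigma> (Suc k)))"
    unfolding mass_eq_M by (rule M_mono) (use d g r \<delta>_pos[of k] in \<open>auto simp: I_borel mem_I ball_eq_greaterThanLessThan\<close>)
  then show "mass v \<le> D ^ 17 * mass w" using ball[OF w] by linarith
  have "mass w \<le> M (ball (lft v) (16 * real ?n * \<sigma> (Suc k)))"
    unfolding mass_eq_M by (rule M_mono) (use d g r \<delta>_pos[of k] in \<open>auto simp: I_borel mem_I ball_eq_greaterThanLessThan\<close>)
  then show "mass w \<le> D ^ 17 * mass v" using ball[OF v] by linarith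
qed

text \<open>
  Uniformity of ratio vectors in one stroke for single and for concatenated vectors.  Every window contains
  a run in one parent of at least half its length; the ball around this run covers every touching window,
  across the gap \<open>\<gamma>\<close> too because \<open>\<gamma> \<le> (s + 1) \<sigma>\<close> bounds it by the window length.  Replacing the
  denominators \<open>b\<close> by one another costs the factor \<open>B\<^sup>2\<close>.
\<close>

lemma uniform_from_cells:
  fixes P :: "real list" and f :: "nat \<Rightarrow> nat list" and b :: "nat \<Rightarrow> real"
  assumes s: "1 \<le> s" "s \<le> length P"
    and f: "\<And>z. z < length P \<Longrightarrow> f z \<in> words n (Suc k)" "inj_on f {..<length P}"
    and P: "\<And>z. z < length P \<Longrightarrow> P ! z = mass (f z) / b z"
    and b: "\<And>z. z < length P \<Longrightarrow> 0 < b z" "\<And>z z'. z < length P \<Longrightarrow> z' < length P \<Longrightarrow> b z \<le> B * b z'"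
    and dist: "\<And>x z z' m. z < length P \<Longrightarrow> z' < length P \<Longrightarrow> z < z' + m \<Longrightarrow> z' < z + m \<Longrightarrow> x \<in> I (f z) \<Longrightarrow>
        \<bar>x - lft (f z')\<bar> \<le> real m * \<sigma> (Suc k) + \<gamma>"
    and \<gamma>: "\<gamma> \<le> (real s + 1) * \<sigma> (Suc k)"
    and half: "\<And>a l. 1 \<le> l \<Longrightarrow> a + l \<le> length P \<Longrightarrow>
        \<exists>a' l' u d. a \<le> a' \<and> a' + l' \<le> a + l \<and> 1 \<le> l' \<and> l \<le> 2 * l' \<and> u \<in> words n k \<and>
          d + l' \<le> n (Suc k) \<and> (\<forall>i<l'. f (a' + i) = u @ [Suc (d + i)])"
  shows "uniform_from (B * B * D ^ 17) s P"
proof -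
  let ?s = "\<sigma> (Suc k)"
  have \<sigma>0: "0 < ?s" by (rule \<sigma>_bounds) simp
  have "0 < length P" using s by linarith
  then have "0 < b 0" "b 0 \<le> B * b 0" using b by blast+
  then have B1: "1 \<le> B" by simp
  have D0: "0 < D" using D_ge_1 by simp
  have Ppos: "0 < P ! z" if "z < length P" for z
    using that f(1) mass_pos P b(1) by (metis divide_pos_pos)
  show ?thesis
  proof (rule uniform_fromI[OF _ s Ppos])
    show "1 \<le> B * B * D ^ 17" using B1 D_ge_1 by (simp add: mult_ge1_I)
  next
    fix a a0 l
    assume l: "s \<le> l" "a + l \<le> length P" "a0 + l \<le> length P" "a \<le> a0 + l" "a0 \<le> a + l"
    obtain a' l' u d where h: "a0 \<le> a'" "a' + l' \<le> a0 + l" "1 \<le> l'" "l \<le> 2 * l'" "u \<in> words n k"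
        "d + l' \<le> n (Suc k)" and fu: "\<And>i. i < l' \<Longrightarrow> f (a' + i) = u @ [Suc (d + i)]"
      using half[of l a0] l s by force
    have a': "a' < length P" using h l by linarith
    define \<beta> where "\<beta> = b a'"
    have \<beta>: "0 < \<beta>" using b(1) a' by (simp add: \<beta>_def)
    define Q where "Q = (\<Sum>z=d..<d+l'. mass (u @ [Suc z]))"
    have center: "lft (f a') = lft u + real d * ?s"
      using fu[of 0] h by (simp add: lft_child words_length)
    \<comment> \<open>all cells of the first window lie within \<open>4 l \<sigma> \<le> 8 l' \<sigma>\<close> of the run \<open>Q\<close> chosen in the second\<close>
    have "(\<Sum>z=a..<a+l. mass (f z)) \<le> M (ball (lft u + real d * ?s) (16 * real l' * ?s))"
    proof (rule sum_mass_le_M[where k = "Suc k"])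
      show "inj_on f {a..<a + l}" by (rule inj_on_subset[OF f(2)]) (use l in auto)
      fix z assume z: "z \<in> {a..<a + l}"
      then show "f z \<in> words n (Suc k)" using f(1) l by simp
      show "I (f z) \<inter> E \<subseteq> ball (lft u + real d * ?s) (16 * real l' * ?s)"
      proof
        fix x assume x: "x \<in> I (f z) \<inter> E"
        have "\<bar>x - lft (f a')\<bar> \<le> real (2 * l) * ?s + \<gamma>"
          using z l h s x by (intro dist[of z]) auto
        also have "\<dots> \<le> real (2 * l) * ?s + (real s + 1) * ?s" using \<gamma> by simp
        also have "\<dots> = (real (2 * l) + real s + 1) * ?s" by (simp add: algebra_simps)
        also have "\<dots> < (16 * real l') * ?s"
          using l h s \<sigma>0 by (intro mult_strict_right_mono) linarith+
        finally show "x \<in> ball (lft u + real d * ?s) (16 * real l' * ?s)"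
          by (simp add: center dist_real_def abs_minus_commute)
      qed
    qed auto
    also have "\<dots> \<le> D ^ 17 * Q" unfolding Q_def by (rule run_ball[OF h(5,3,6)])
    finally have num: "(\<Sum>z=a..<a+l. mass (f z)) \<le> D ^ 17 * Q" .
    have "(\<Sum>z=a..<a+l. P ! z) \<le> (\<Sum>z=a..<a+l. B / \<beta> * mass (f z))"
    proof (rule sum_mono)
      fix z assume "z \<in> {a..<a + l}"
      then have z: "z < length P" using l by simp
      have "\<beta> * P ! z \<le> (B * b z) * P ! z"
        using b(2)[OF a' z] Ppos[OF z] by (intro mult_right_mono) (auto simp: \<beta>_def)
      also have "\<dots> = B * mass (f z)" using P[OF z] b(1)[OF z] by simp
      finally show "P ! z \<le> B / \<beta> * mass (f z)" using \<beta> by (simp add: field_simps)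
    qed
    also have "\<dots> \<le> B / \<beta> * (D ^ 17 * Q)"
      unfolding sum_distrib_left[symmetric] using num B1 \<beta> by (intro mult_left_mono) auto
    finally have A: "(\<Sum>z=a..<a+l. P ! z) \<le> B / \<beta> * (D ^ 17 * Q)" .
    have "Q = (\<Sum>i<l'. mass (f (a' + i)))"
      unfolding Q_def by (subst sum.atLeastLessThan_shift_0) (simp add: fu atLeast0LessThan)
    also have "\<dots> \<le> (\<Sum>i<l'. B * \<beta> * P ! (a' + i))"
    proof (rule sum_mono)
      fix i assume "i \<in> {..<l'}"
      then have z: "a' + i < length P" using h l by simp
      have "mass (f (a' + i)) = b (a' + i) * P ! (a' + i)" using P[OF z] b(1)[OF z] by simp
      also have "\<dots> \<le> (B * \<beta>) * P ! (a' + i)"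
        using b(2)[OF z a'] Ppos[OF z] by (intro mult_right_mono) (auto simp: \<beta>_def)
      finally show "mass (f (a' + i)) \<le> B * \<beta> * P ! (a' + i)" .
    qed
    also have "\<dots> = B * \<beta> * (\<Sum>z=a'..<a'+l'. P ! z)"
      unfolding sum_distrib_left[symmetric]
      by (subst sum.atLeastLessThan_shift_0[of _ a']) (simp add: atLeast0LessThan)
    also have "(\<Sum>z=a'..<a'+l'. P ! z) \<le> (\<Sum>z=a0..<a0+l. P ! z)"
      using h l Ppos by (intro sum_mono2) (auto intro: less_imp_le)
    finally have Q: "Q \<le> B * \<beta> * (\<Sum>z=a0..<a0+l. P ! z)" using B1 \<beta> by (simp add: mult_left_mono)
    have "B / \<beta> * (D ^ 17 * Q) \<le> B / \<beta> * (D ^ 17 * (B * \<beta> * (\<Sum>z=a0..<a0+l. P ! z)))"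
      using Q B1 \<beta> D0 by (intro mult_left_mono) auto
    also have "\<dots> = B * B * D ^ 17 * (\<Sum>z=a0..<a0+l. P ! z)" using \<beta> by simp
    finally show "(\<Sum>m=a..<a+l. P ! m) \<le> B * B * D ^ 17 * (\<Sum>m=a0..<a0+l. P ! m)" using A by linarith
  qed
qed

lemma ratios_uniform:
  assumes w: "w \<in> words n k"
  shows "uniform_vec (D ^ 17) (ratios w)"
proof -
  let ?s = "\<sigma> (Suc k)"
  have len: "length w = k" using w words_length by simp
  have \<sigma>0: "0 < ?s" "\<delta> (Suc k) < ?s" by (rule \<sigma>_bounds; simp)+
  have "uniform_from (1 * 1 * D ^ 17) 1 (ratios w)"
  proof (rule uniform_from_cells[where f = "\<lambda>z. w @ [Suc z]" and b = "\<lambda>_. mass w" and k = k and \<gamma> = 0])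
    show "1 \<le> length (ratios w)" using n_ge_2[of "Suc k"] by (simp add: len)
  next
    fix x z z' m
    assume z: "z < z' + m" "z' < z + m" "x \<in> I (w @ [Suc z])"
    have "real z \<le> real z' + real m - 1" "real z' \<le> real z + real m - 1" using z by linarith+
    then have "real z * ?s \<le> (real z' + real m - 1) * ?s" "real z' * ?s \<le> (real z + real m - 1) * ?s"
      using \<sigma>0 by (intro mult_right_mono; simp)+
    then show "\<bar>x - lft (w @ [Suc z'])\<bar> \<le> real m * ?s + 0"
      using z(3) \<sigma>0 by (simp add: mem_I lft_child rgt_child len abs_le_iff algebra_simps)
  next
    fix a l assume "1 \<le> l" "a + l \<le> length (ratios w)"
    then show "\<exists>a' l' u d. a \<le> a' \<and> a' + l' \<le> a + l \<and> 1 \<le> l' \<and> l \<le> 2 * l' \<and> u \<in> words n k \<and>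
          d + l' \<le> n (Suc k) \<and> (\<forall>i<l'. w @ [Suc (a' + i)] = u @ [Suc (d + i)])"
      using w by (intro exI[of _ a] exI[of _ l] exI[of _ w] exI[of _ a]) (simp add: len)
  qed (use w \<sigma>0 mass_pos[OF w] in \<open>auto simp: len nth_ratios inj_on_def intro: words_child\<close>)
  then show ?thesis by simp
qed

lemma ratios_pair_uniform:
  assumes v: "v \<in> words n k" and w: "w \<in> words n k" and "v \<noteq> w"
    and g: "lft w = rgt v + \<gamma>" "0 \<le> \<gamma>" "\<gamma> \<le> \<delta> k" and s: "1 \<le> s" "s \<le> 2 * n (Suc k)"
    and \<gamma>: "\<gamma> \<le> (real s + 1) * \<sigma> (Suc k)"
  shows "uniform_from (D ^ 51) s (ratios v @ ratios w)"
proof -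
  let ?s = "\<sigma> (Suc k)" and ?n = "n (Suc k)"
  let ?b = "\<lambda>z. if z < ?n then mass v else mass w"
  have len: "length v = k" "length w = k" using v w words_length by auto
  have L: "length (ratios v @ ratios w) = 2 * ?n" by (simp add: len)
  have \<sigma>0: "0 < ?s" "\<delta> (Suc k) < ?s" by (rule \<sigma>_bounds; simp)+
  have self: "mass u \<le> D ^ 17 * mass u" for u
    using D_power_mono[of 0 17 "mass u"] mass_nonneg[of u] by simp
  have "uniform_from (D ^ 17 * D ^ 17 * D ^ 17) s (ratios v @ ratios w)"
  proof (rule uniform_from_cells[where f = "cell v w" and b = ?b and k = k and \<gamma> = \<gamma>])
    fix z z' assume "z < length (ratios v @ ratios w)" "z' < length (ratios v @ ratios w)"
    show "?b z \<le> D ^ 17 * ?b z'" using neighbour_mass[OF v w g] self by simp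
  next
    fix x z z' m
    assume z: "z < length (ratios v @ ratios w)" "z' < length (ratios v @ ratios w)"
      "z < z' + m" "z' < z + m" "x \<in> I (cell v w z)"
    have zz: "z < 2 * ?n" "z' < 2 * ?n" using z(1,2) unfolding L by auto
    have l: "lft (cell v w z') \<in> I (cell v w z')" using lft_less_rgt by (simp add: mem_I less_imp_le)
    show "\<bar>x - lft (cell v w z')\<bar> \<le> real m * ?s + \<gamma>"
    proof (cases "z \<le> z'")
      case True
      have "\<bar>lft (cell v w z') - x\<bar> \<le> (real z' - real z + 1) * ?s + \<gamma>"
        by (rule cell_distance(2)[OF v w g(1,2) zz True z(5) l])
      moreover have "(real z' - real z + 1) * ?s \<le> real m * ?s"
        using z(4) \<sigma>0 by (intro mult_right_mono) auto
      ultimately show ?thesis by linarith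
    next
      case False
      then have "\<bar>x - lft (cell v w z')\<bar> \<le> (real z - real z' + 1) * ?s + \<gamma>"
        by (intro cell_distance(2)[OF v w g(1,2) zz(2,1) _ l z(5)]) simp
      moreover have "(real z - real z' + 1) * ?s \<le> real m * ?s"
        using z(3) \<sigma>0 by (intro mult_right_mono) auto
      ultimately show ?thesis by linarith
    qed
  next
    fix a l assume al: "1 \<le> l" "a + l \<le> length (ratios v @ ratios w)"
    have cell_v: "cell v w z = v @ [Suc z]" if "z < ?n" for z using that cell_simps(1)[OF len(1)] by simp
    have cell_w: "cell v w (?n + z) = w @ [Suc z]" for z using cell_simps(2)[OF len(1)] by simp
    consider "a < ?n" "l \<le> 2 * (?n - a)" | "a < ?n" "2 * (?n - a) < l" | "?n \<le> a" by linarith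
    then show "\<exists>a' l' u d. a \<le> a' \<and> a' + l' \<le> a + l \<and> 1 \<le> l' \<and> l \<le> 2 * l' \<and> u \<in> words n k \<and>
          d + l' \<le> ?n \<and> (\<forall>i<l'. cell v w (a' + i) = u @ [Suc (d + i)])"
    proof cases
      case 1
      then show ?thesis using v al
        by (intro exI[of _ a] exI[of _ "min l (?n - a)"] exI[of _ v] exI[of _ a]) (auto simp: cell_v)
    next
      case 2
      then show ?thesis using w al L cell_w
        by (intro exI[of _ ?n] exI[of _ "a + l - ?n"] exI[of _ w] exI[of _ 0]) auto
    next
      case 3
      then have "cell v w (a + i) = w @ [Suc (a - ?n + i)]" for i
        using cell_w[of "a - ?n + i"] by (simp add: add.assoc)
      then show ?thesis using 3 w al L
        by (intro exI[of _ a] exI[of _ l] exI[of _ w] exI[of _ "a - ?n"]) auto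
    qed
  next
    show "cell v w z \<in> words n (Suc k)" if "z < length (ratios v @ ratios w)" for z
      using that cell_words[OF v w, of z] unfolding L by simp
    show "inj_on (cell v w) {..<length (ratios v @ ratios w)}"
      unfolding L by (rule inj_on_cell[OF v w \<open>v \<noteq> w\<close>])
    show "(ratios v @ ratios w) ! z = mass (cell v w z) / ?b z" if "z < length (ratios v @ ratios w)" for z
      using that nth_ratios_append[OF v w, of z] unfolding L by simp
    show "s \<le> length (ratios v @ ratios w)" unfolding L by (rule s)
    show "0 < ?b z" for z using mass_pos v w by simp
  qed (use s \<gamma> in auto)
  then show ?thesis by (simp flip: power_add)
qed

text \<open>
  Condition (a) uses levels at which the gap is still shorter than the components, so windows of length
  \<open>1\<close> already exceed it; in condition (b) the block length is chosen so that
  windows of at least this length are not essentially shorter than the gap.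
\<close>

lemma doubling_imp_adapted: "adapted (D ^ 51 + 1)"
proof -
  let ?C = "D ^ 51 + 1"
  have D0: "0 < D" using D_ge_1 by simp
  have C: "D ^ 51 \<le> ?C" "D ^ 34 \<le> ?C" "D ^ 17 \<le> ?C"
    using power_increasing[OF _ D_ge_1, of 34 51] power_increasing[OF _ D_ge_1, of 17 51] by auto
  have single: "uniform_vec ?C (ratios w)" if "w \<in> all_words n" for w
    using that ratios_uniform C(3) uniform_from_mono unfolding all_words_def by blast
  show ?thesis unfolding adapted_def
  proof (intro conjI ballI allI impI single; assumption?)
    fix k w i t
    assume k: "k \<in> large_gap_levels n c" and w: "w \<in> words n (k - 1)"
      and it: "1 \<le> i \<and> i < n k \<and> 1 \<le> t \<and> t < depth_idx n c k"
    obtain k' where k': "k = Suc k'" using k by (cases k) (auto simp: large_gap_levels_def)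
    obtain t' where t': "t = Suc t'" using it by (cases t) auto
    have w': "w \<in> words n k'" and i: "1 \<le> i" "i < n (Suc k')" using w it k' by auto
    note e = sibling_ext[OF w' i]
    have gap: "\<epsilon> (Suc k') \<le> \<delta> (Suc k' + s)" if "s \<le> t" for s
      using less_depth_idx[OF k, of s] that it k' by simp
    have g0: "0 \<le> \<epsilon> (Suc k')" using \<epsilon>_pos[of "Suc k'"] by simp
    have t1: "t - 1 = t'" using t' by simp
    show "uniform_vec ?C (ratios (max_word_ext n (w @ [i]) (t - 1)) @ ratios (min_word_ext (w @ [i + 1]) (t - 1)))"
      unfolding t1
    proof (rule uniform_from_mono[OF ratios_pair_uniform[OF e(1) e(2) e(4) e(3) g0] C(1)])
      show "\<epsilon> (Suc k') \<le> \<delta> (Suc k' + t')" using gap t' by simp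
      show "1 \<le> 2 * n (Suc (Suc k' + t'))" using n_ge_2[of "Suc (Suc k' + t')"] by simp
      have "\<epsilon> (Suc k') \<le> \<delta> (Suc (Suc k' + t'))" using gap[of t] t' by simp
      then show "\<epsilon> (Suc k') \<le> (real 1 + 1) * \<sigma> (Suc (Suc k' + t'))"
        using \<sigma>_bounds[of "Suc (Suc k' + t')"] by simp
    qed simp
    have m: "mass (max_word_ext n (w @ [i]) s) \<le> D ^ 17 * mass (min_word_ext (w @ [i + 1]) s)"
      "mass (min_word_ext (w @ [i + 1]) s) \<le> D ^ 17 * mass (max_word_ext n (w @ [i]) s)" if "s \<le> t" for s
      using neighbour_mass[OF e(1)[of s] e(2)[of s] e(3)[of s] g0 gap[OF that]] by auto
    have pos: "0 < mass (max_word_ext n (w @ [i]) s)" "0 < mass (min_word_ext (w @ [i + 1]) s)" for s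
      using e(1,2)[of s] mass_pos by blast+
    have root: "w @ [i] \<in> words n (Suc k')" "w @ [i + 1] \<in> words n (Suc k')"
      using e(1,2)[of 0] by auto
    have cross: "x / x0 \<le> ?C * (y / y0)"
      if "x \<le> D ^ 17 * y" "y0 \<le> D ^ 17 * x0" "0 < x0" "0 < y0" "0 < y" for x x0 y y0 :: real
    proof -
      have "x * y0 \<le> (D ^ 17 * y) * (D ^ 17 * x0)"
        using that D0 by (intro mult_mono) auto
      then have "x * y0 \<le> D ^ 34 * (y * x0)" by (simp add: algebra_simps flip: power_add)
      also have "\<dots> \<le> ?C * (y * x0)" using C(2) that by (intro mult_right_mono) auto
      finally show ?thesis using that by (simp add: divide_simps mult.commute mult.left_commute)
    qed
    show "(\<Prod>j=1..t. word_ratio n c \<mu> (min_word_ext (w @ [i + 1]) j))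
        \<le> ?C * (\<Prod>j=1..t. word_ratio n c \<mu> (max_word_ext n (w @ [i]) j))"
      unfolding prod_ratio_ext[OF root(1)] prod_ratio_ext[OF root(2)]
      using m[of t] m[of 0] pos[of t] pos[of 0] by (intro cross) auto
    have inv: "inverse ?C * x \<le> y" if "x \<le> ?C * y" for x y
      using that D0 by (simp add: inverse_eq_divide pos_divide_le_eq add_pos_pos mult.commute)
    show "inverse ?C * (\<Prod>j=1..t. word_ratio n c \<mu> (max_word_ext n (w @ [i]) j))
        \<le> (\<Prod>j=1..t. word_ratio n c \<mu> (min_word_ext (w @ [i + 1]) j))"
      unfolding prod_ratio_ext[OF root(1)] prod_ratio_ext[OF root(2)]
      using m[of t] m[of 0] pos[of t] pos[of 0] by (intro inv cross) auto
  next
    fix k w i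
    assume k: "k \<in> large_gap_levels n c" and w: "w \<in> words n (k - 1)" and i0: "1 \<le> i \<and> i < n k"
    obtain k' where k': "k = Suc k'" using k by (cases k) (auto simp: large_gap_levels_def)
    obtain t where t: "depth_idx n c k = Suc t" using depth_idx_props(1)[OF k] by (cases "depth_idx n c k") auto
    have t1: "depth_idx n c k - 1 = t" using t by simp
    have w': "w \<in> words n k'" and i: "1 \<le> i" "i < n (Suc k')" using w i0 k' by auto
    note e = sibling_ext[OF w' i, of t]
    have g0: "0 \<le> \<epsilon> (Suc k')" using \<epsilon>_pos[of "Suc k'"] by simp
    have q: "k + depth_idx n c k = Suc (Suc k' + t)" using k' t by simp
    note s = block_idx_props[OF k, unfolded q]
    show "uniform_from ?C (block_idx n c k)
        (ratios (max_word_ext n (w @ [i]) (depth_idx n c k - 1)) @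
         ratios (min_word_ext (w @ [i + 1]) (depth_idx n c k - 1)))"
      unfolding t1
    proof (rule uniform_from_mono[OF ratios_pair_uniform[OF e(1) e(2) e(4) e(3) g0] C(1)])
      show "\<epsilon> (Suc k') \<le> \<delta> (Suc k' + t)" using less_depth_idx[OF k, of t] t k' by simp
      show "1 \<le> block_idx n c k" by (rule s)
      show "block_idx n c k \<le> 2 * n (Suc (Suc k' + t))" using s(4) by simp
      show "\<epsilon> (Suc k') \<le> (real (block_idx n c k) + 1) * \<sigma> (Suc (Suc k' + t))"
        using s(3) unfolding k' by simp
    qed
  qed
qed

end

section \<open>Uniformity implies doubling\<close>

locale adapted_cantor_measure = cantor_measure n c \<mu> for n c \<mu> +
  fixes C :: real
  assumes C_ge_1: "1 \<le> C" and adapted: "adapted C"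
    and root_uniform: "uniform_vec C (ratio_vec n c \<mu> [])"
begin

lemma C_power_mono: "i \<le> j \<Longrightarrow> 0 \<le> a \<Longrightarrow> C ^ i * a \<le> C ^ j * a"
  using C_ge_1 by (intro mult_right_mono power_increasing) auto

lemma single_uniform: "w \<in> words n k \<Longrightarrow> uniform_vec C (ratios w)"
  using adapted root_uniform unfolding adapted_def all_words_def
  by (cases "k = 0") (auto simp: words_0[OF params] Suc_le_eq)

text \<open>
  If the gap is shorter than the two neighbours, one of the conditions (a) and (b) applies to their
  concatenated ratio vectors.  In both cases the admissible window length \<open>S\<close> is bounded by the larger of \<open>1\<close> and
  the number of children that fit into the gap, and it is \<open>1\<close> if the gap is shorter than
  two children.
\<close>

lemma pair_uniform:
  assumes adj: "adjacent v v' \<gamma> q" and \<gamma>: "\<gamma> < \<delta> q"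
  obtains S where "1 \<le> S" "S \<le> n (Suc q)" "uniform_from C S (ratios v @ ratios v')"
    "real S * \<sigma> (Suc q) \<le> max (\<sigma> (Suc q)) (\<gamma> + \<epsilon> (Suc q))"
    "\<gamma> < 2 * \<delta> (Suc q) \<Longrightarrow> S = 1"
proof -
  obtain k w i t where w: "w \<in> words n k" "1 \<le> i" "i < n (Suc k)" and
    q: "q = Suc k + t" "\<gamma> = \<epsilon> (Suc k)" "v = max_word_ext n (w @ [i]) t" "v' = min_word_ext (w @ [i + 1]) t"
    using adj unfolding adjacent_def by blast
  have "\<gamma> < \<delta> (Suc k)" using \<gamma> \<delta>_antimono[of "Suc k" q] q by simp
  then have L: "Suc k \<in> large_gap_levels n c" by (simp add: large_gap_levels_def q)
  note m = depth_idx_props[OF L]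
  have "t < depth_idx n c (Suc k)"
  proof (rule ccontr)
    assume "\<not> ?thesis"
    then show False using m(2) \<gamma> \<delta>_antimono[of "Suc k + depth_idx n c (Suc k)" q] q by simp
  qed
  then consider "Suc t < depth_idx n c (Suc k)" | "depth_idx n c (Suc k) = Suc t" by linarith
  then show ?thesis
  proof cases
    case 1
    then have u: "uniform_vec C (ratios v @ ratios v')"
      using adapted L w unfolding adapted_def q
      by (metis (no_types, lifting) diff_Suc_1 le_add1 plus_1_eq_Suc)
    show ?thesis using n_ge_2[of "Suc q"] by (intro that[OF _ _ u]) auto
  next
    case 2
    then have "uniform_from C (block_idx n c (Suc k)) (ratios v @ ratios v')"
      using adapted L w unfolding adapted_def q by (metis (no_types, lifting) diff_Suc_1)
    moreover have qq: "Suc k + depth_idx n c (Suc k) = Suc q" using 2 q by simp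
    note s = block_idx_props[OF L, unfolded qq, folded q(2)]
    moreover have "block_idx n c (Suc k) = 1" if "\<gamma> < 2 * \<delta> (Suc q)"
    proof (rule ccontr)
      assume "block_idx n c (Suc k) \<noteq> 1"
      then have "2 * \<sigma> (Suc q) \<le> real (block_idx n c (Suc k)) * \<sigma> (Suc q)"
        using s(1) \<sigma>_bounds(3)[of "Suc q"] by (intro mult_right_mono) auto
      then show False using s(2) that \<epsilon>_pos[of "Suc q"] by (simp add: period_def)
    qed
    ultimately show ?thesis by (intro that[of "block_idx n c (Suc k)"]) auto
  qed
qed

lemma sibling_mass:
  assumes w: "w \<in> words n k" and z: "Suc z < n (Suc k)"
  shows "mass (w @ [Suc z]) \<le> C * mass (w @ [Suc (Suc z)])"
    "mass (w @ [Suc (Suc z)]) \<le> C * mass (w @ [Suc z])"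
proof -
  have len: "length w = k" using w words_length by auto
  note step = uniform_from_window_step[OF single_uniform[OF w], of 1]
  have "ratios w ! z \<le> C * ratios w ! Suc z" "ratios w ! Suc z \<le> C * ratios w ! z"
    using step[of z "Suc z"] step[of "Suc z" z] z by (auto simp: len)
  then show "mass (w @ [Suc z]) \<le> C * mass (w @ [Suc (Suc z)])"
    "mass (w @ [Suc (Suc z)]) \<le> C * mass (w @ [Suc z])"
    using z mass_pos[OF w] by (simp_all add: nth_ratios len pos_divide_le_eq)
qed

text \<open>
  Neighbours with a gap shorter than two of their lengths have comparable masses.  While the gap is shorter
  than the components, this is the product condition in (a), starting from siblings.  The one further
  level that occurs is the first at which the components are not longer than the gap; there the block
  length is \<open>1\<close>, and (b) compares the two components through their comparable parents.
\<close>

lemma adjacent_mass: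
  assumes adj: "adjacent v v' \<gamma> q" and \<gamma>: "\<gamma> < 2 * \<delta> q"
  shows "mass v \<le> C ^ 3 * mass v' \<and> mass v' \<le> C ^ 3 * mass v"
proof -
  obtain k w i t where w: "w \<in> words n k" "1 \<le> i" "i < n (Suc k)" and
    q: "q = Suc k + t" "\<gamma> = \<epsilon> (Suc k)" "v = max_word_ext n (w @ [i]) t" "v' = min_word_ext (w @ [i + 1]) t"
    using adj unfolding adjacent_def by blast
  obtain j where j: "i = Suc j" using w by (cases i) auto
  let ?u = "\<lambda>s. max_word_ext n (w @ [i]) s" and ?u' = "\<lambda>s. min_word_ext (w @ [i + 1]) s"
  note e = sibling_ext[OF w]
  have pos: "0 < mass (?u s)" "0 < mass (?u' s)" for s using e(1,2) mass_pos by blast+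
  have root: "w @ [i] \<in> words n (Suc k)" "w @ [i + 1] \<in> words n (Suc k)" using e(1,2)[of 0] by auto
  have base: "mass (?u 0) \<le> C * mass (?u' 0)" "mass (?u' 0) \<le> C * mass (?u 0)"
    using sibling_mass[OF w(1), of j] w j by auto
  have C0: "0 < C" using C_ge_1 by simp
  have up: "x \<le> C ^ b * y" if "x \<le> C ^ a * y" "a \<le> b" "0 < y" for x y :: real and a b
    using that C_power_mono[of a b y] by linarith
  have mul: "x \<le> C ^ (a + b) * y" if "x / x0 \<le> C ^ a * (y / y0)" "x0 \<le> C ^ b * y0"
    "0 < x0" "0 < y0" "0 < y" for x x0 y y0 :: real and a b
  proof -
    have "x \<le> (C ^ a * (y / y0)) * x0" using that(1,3) by (simp add: pos_divide_le_eq)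
    also have "\<dots> \<le> (C ^ a * (y / y0)) * (C ^ b * y0)" using that C0 by (intro mult_left_mono) auto
    also have "\<dots> = C ^ (a + b) * y" using that by (simp add: power_add)
    finally show ?thesis .
  qed
  have inv: "x \<le> C ^ 1 * y" if "inverse C * x \<le> y" for x y
    using that C0 by (simp add: inverse_eq_divide pos_divide_le_eq mult.commute)
  have shallow: "mass (?u s) \<le> C ^ 2 * mass (?u' s) \<and> mass (?u' s) \<le> C ^ 2 * mass (?u s)"
    if s: "\<epsilon> (Suc k) < \<delta> (Suc k + s)" for s
  proof (cases "s = 0")
    case True
    then show ?thesis using base up[of _ 1 _ 2] pos[of 0] by simp
  next
    case False
    have "\<epsilon> (Suc k) < \<delta> (Suc k)" using s \<delta>_antimono[of "Suc k" "Suc k + s"] by simp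
    then have L: "Suc k \<in> large_gap_levels n c" by (simp add: large_gap_levels_def)
    have "s < depth_idx n c (Suc k)"
    proof (rule ccontr)
      assume "\<not> ?thesis"
      then show False using depth_idx_props(2)[OF L] s \<delta>_antimono[of "Suc k + depth_idx n c (Suc k)" "Suc k + s"] by simp
    qed
    then have "inverse C * (\<Prod>j=1..s. word_ratio n c \<mu> (?u j)) \<le> (\<Prod>j=1..s. word_ratio n c \<mu> (?u' j))"
      "(\<Prod>j=1..s. word_ratio n c \<mu> (?u' j)) \<le> C * (\<Prod>j=1..s. word_ratio n c \<mu> (?u j))"
      using adapted L w False unfolding adapted_def by (metis (no_types, lifting) Suc_le_eq diff_Suc_1 neq0_conv One_nat_def)+
    then have "mass (?u s) / mass (w @ [i]) \<le> C ^ 1 * (mass (?u' s) / mass (w @ [i + 1]))"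
      "mass (?u' s) / mass (w @ [i + 1]) \<le> C ^ 1 * (mass (?u s) / mass (w @ [i]))"
      unfolding prod_ratio_ext[OF root(1)] prod_ratio_ext[OF root(2)]
      by (blast intro: inv, simp)
    from mul[OF this(1), of 1] mul[OF this(2), of 1] base pos[of 0] pos[of s]
    show ?thesis by (simp add: numeral_2_eq_2)
  qed
  show ?thesis
  proof (cases "t = 0 \<or> \<epsilon> (Suc k) < \<delta> q")
    case True
    then have "mass v \<le> C ^ 2 * mass v' \<and> mass v' \<le> C ^ 2 * mass v"
    proof
      assume "t = 0"
      then show ?thesis unfolding q using base up[of _ 1 _ 2] pos[of 0] by simp
    next
      assume "\<epsilon> (Suc k) < \<delta> q"
      then show ?thesis unfolding q by (intro shallow)
    qed
    then show ?thesis using up[of _ 2 _ 3] pos[of t] unfolding q by simp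
  next
    case False
    then obtain t' where t': "t = Suc t'" by (cases t) auto
    \<comment> \<open>here the gap is at least \<open>\<delta> q\<close> but shorter than the parents, and the block length is \<open>1\<close>\<close>
    define p where "p = Suc k + t'"
    have qp: "q = Suc p" using q t' by (simp add: p_def)
    have \<gamma>p: "\<gamma> < \<delta> p" using \<gamma> \<delta>_halves[of p] qp by simp
    have adj': "adjacent (?u t') (?u' t') \<gamma> p" unfolding adjacent_def p_def q(2) using w by blast
    obtain S where S: "uniform_from C S (ratios (?u t') @ ratios (?u' t'))" "S = 1"
    proof -
      obtain S where "uniform_from C S (ratios (?u t') @ ratios (?u' t'))"
        "\<gamma> < 2 * \<delta> (Suc p) \<Longrightarrow> S = 1"
        using pair_uniform[OF adj' \<gamma>p] by metis
      then show ?thesis using that False \<gamma> q(2) qp by simp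
    qed
    obtain N where N: "n (Suc p) = Suc N" using n_ge_2[of "Suc p"] by (cases "n (Suc p)") auto
    define Q where "Q = ratios (?u t') @ ratios (?u' t')"
    have uw: "?u t' \<in> words n p" "?u' t' \<in> words n p" using e(1,2)[of t'] by (simp_all add: p_def)
    note len = words_length[OF uw(1)] words_length[OF uw(2)]
    have lenQ: "length Q = 2 * Suc N" unfolding Q_def length_append length_ratios len N by simp
    note step = uniform_from_window_step[OF S(1)[unfolded S(2), folded Q_def], of 1]
    have "Q ! N \<le> C * Q ! Suc N" "Q ! Suc N \<le> C * Q ! N"
      using step[of N "Suc N"] step[of "Suc N" N] lenQ by auto
    moreover have "Q ! N = mass v / mass (?u t')"
    proof -
      have "cell (?u t') (?u' t') N = v"
        unfolding q(3) t' max_word_ext_Suc cell_def Let_def len N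
        using words_length[OF w(1)] N by (simp add: p_def)
      then show ?thesis using nth_ratios_append[OF uw, of N] N by (simp add: Q_def)
    qed
    moreover have "Q ! Suc N = mass v' / mass (?u' t')"
    proof -
      have "cell (?u t') (?u' t') (Suc N) = v'"
        unfolding q(4) t' min_word_ext_Suc cell_def Let_def len N by simp
      then show ?thesis using nth_ratios_append[OF uw, of "Suc N"] N by (simp add: Q_def)
    qed
    ultimately have r: "mass v / mass (?u t') \<le> C ^ 1 * (mass v' / mass (?u' t'))"
      "mass v' / mass (?u' t') \<le> C ^ 1 * (mass v / mass (?u t'))" by simp_all
    have "\<epsilon> (Suc k) < \<delta> (Suc k + t')" using \<gamma>p q(2) by (simp add: p_def)
    note sh = shallow[OF this]
    show ?thesis
      using mul[OF r(1), of 2] mul[OF r(2), of 2] sh pos[of t'] pos[of t] unfolding q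
      by (simp add: power3_eq_cube power2_eq_square mult.assoc)
  qed
qed

text \<open>
  Up to the distance \<open>\<delta> q\<close> from a component of level \<open>q\<close> there is at most its neighbour.
\<close>

lemma left_reach:
  assumes w: "w \<in> words n q" and "0 < \<rho>" "\<rho> \<le> \<delta> q"
  shows "M {lft w - \<rho><..<lft w} \<le> C ^ 3 * mass w"
proof -
  have z: "0 \<le> C ^ 3 * mass w" using C_ge_1 mass_nonneg by simp
  consider "lft w = 0" | v \<gamma> where "adjacent v w \<gamma> q" using left_neighbour[OF w] by blast
  then show ?thesis
  proof cases
    case 1
    then have "{lft w - \<rho><..<lft w} \<inter> E = {}" using E_bounds by fastforce
    then show ?thesis using z by (simp add: M_null)
  next
    case (2 v \<gamma>)
    note a = adjacent_props[OF 2] and gap = adjacent_gap_empty[OF 2]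
    have rgt_v: "rgt v = lft v + \<delta> q" using words_length[OF a(1)] by (simp add: rgt_def)
    show ?thesis
    proof (cases "\<rho> \<le> \<gamma>")
      case True
      have "{lft w - \<rho><..<lft w} \<inter> E = {}" using gap a(4) True by fastforce
      then show ?thesis using z by (simp add: M_null)
    next
      case False
      have "M {lft w - \<rho><..<lft w} \<le> mass v"
        unfolding mass_eq_M
      proof (rule M_mono)
        show "{lft w - \<rho><..<lft w} \<inter> E \<subseteq> I v"
          using gap a(4,5) assms rgt_v by (fastforce simp: mem_I)
      qed (auto simp: I_borel)
      then show ?thesis using adjacent_mass[OF 2] False assms \<delta>_pos[of q] by fastforce
    qed
  qed
qed

lemma right_reach:
  assumes w: "w \<in> words n q" and "0 < \<rho>" "\<rho> \<le> \<delta> q"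
  shows "M {rgt w<..<rgt w + \<rho>} \<le> C ^ 3 * mass w"
proof -
  have z: "0 \<le> C ^ 3 * mass w" using C_ge_1 mass_nonneg by simp
  consider "rgt w = 1" | v \<gamma> where "adjacent w v \<gamma> q" using right_neighbour[OF w] by blast
  then show ?thesis
  proof cases
    case 1
    then have "{rgt w<..<rgt w + \<rho>} \<inter> E = {}" using E_bounds by fastforce
    then show ?thesis using z by (simp add: M_null)
  next
    case (2 v \<gamma>)
    note a = adjacent_props[OF 2] and gap = adjacent_gap_empty[OF 2]
    have rgt_v: "rgt v = lft v + \<delta> q" using words_length[OF a(2)] by (simp add: rgt_def)
    show ?thesis
    proof (cases "\<rho> \<le> \<gamma>")
      case True
      have "{rgt w<..<rgt w + \<rho>} \<inter> E = {}" using gap a(4) True by fastforce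
      then show ?thesis using z by (simp add: M_null)
    next
      case False
      have "M {rgt w<..<rgt w + \<rho>} \<le> mass v"
        unfolding mass_eq_M
      proof (rule M_mono)
        show "{rgt w<..<rgt w + \<rho>} \<inter> E \<subseteq> I v"
          using gap a(4,5) assms rgt_v by (fastforce simp: mem_I)
      qed (auto simp: I_borel)
      then show ?thesis using adjacent_mass[OF 2] False assms \<delta>_pos[of q] by fastforce
    qed
  qed
qed

text \<open>
  Up to the distance \<open>2 \<delta> q\<close> there are at most two further components on each side, and \<open>adjacent_mass\<close>
  applies to each step.
\<close>

lemma far_reach:
  assumes w: "w \<in> words n q"
  shows "M {lft w - 2 * \<delta> q<..<lft w} \<le> 2 * C ^ 6 * mass w"
    and "M {rgt w<..<rgt w + 2 * \<delta> q} \<le> 2 * C ^ 6 * mass w"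
proof -
  have z: "0 \<le> 2 * C ^ 6 * mass w" using C_ge_1 mass_nonneg by simp
  have d0: "0 < \<delta> q" by (rule \<delta>_pos)
  have two: "x + y \<le> 2 * C ^ 6 * mass w" if "x \<le> C ^ 3 * mass w" "y \<le> C ^ 3 * x" for x y
  proof -
    have "C ^ 3 * x \<le> C ^ 3 * (C ^ 3 * mass w)" using that C_ge_1 by (intro mult_left_mono) auto
    then have "y \<le> C ^ 6 * mass w" using that(2) by (simp flip: power_add mult.assoc)
    moreover have "x \<le> C ^ 6 * mass w"
      using that(1) C_power_mono[of 3 6 "mass w"] mass_nonneg by fastforce
    ultimately show ?thesis by simp
  qed
  show "M {lft w - 2 * \<delta> q<..<lft w} \<le> 2 * C ^ 6 * mass w"
  proof -
    consider "lft w = 0" | v \<gamma> where "adjacent v w \<gamma> q" using left_neighbour[OF w] by blast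
    then show ?thesis
    proof cases
      case 1
      then have "{lft w - 2 * \<delta> q<..<lft w} \<inter> E = {}" using E_bounds by fastforce
      then show ?thesis using z by (simp add: M_null)
    next
      case (2 v \<gamma>)
      note a = adjacent_props[OF 2] and gap = adjacent_gap_empty[OF 2]
      have rgt_v: "rgt v = lft v + \<delta> q" using words_length[OF a(1)] by (simp add: rgt_def)
      show ?thesis
      proof (cases "2 * \<delta> q \<le> \<gamma>")
        case True
        have "{lft w - 2 * \<delta> q<..<lft w} \<inter> E = {}" using gap a(4) True by fastforce
        then show ?thesis using z by (simp add: M_null)
      next
        case False
        have "M {lft w - 2 * \<delta> q<..<lft w} \<le> M (I v) + M {lft v - \<delta> q<..<lft v}"
        proof (rule M_subadditive)
          show "{lft w - 2 * \<delta> q<..<lft w} \<inter> E \<subseteq> I v \<union> {lft v - \<delta> q<..<lft v}"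
            using gap a(4,5) rgt_v by (fastforce simp: mem_I)
        qed (auto simp: I_borel)
        then show ?thesis
          using left_reach[OF a(1) d0 order_refl] adjacent_mass[OF 2] False two[of "mass v"]
          by (fastforce simp: mass_eq_M)
      qed
    qed
  qed
  show "M {rgt w<..<rgt w + 2 * \<delta> q} \<le> 2 * C ^ 6 * mass w"
  proof -
    consider "rgt w = 1" | v \<gamma> where "adjacent w v \<gamma> q" using right_neighbour[OF w] by blast
    then show ?thesis
    proof cases
      case 1
      then have "{rgt w<..<rgt w + 2 * \<delta> q} \<inter> E = {}" using E_bounds by fastforce
      then show ?thesis using z by (simp add: M_null)
    next
      case (2 v \<gamma>)
      note a = adjacent_props[OF 2] and gap = adjacent_gap_empty[OF 2]
      have rgt_v: "rgt v = lft v + \<delta> q" using words_length[OF a(2)] by (simp add: rgt_def)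
      show ?thesis
      proof (cases "2 * \<delta> q \<le> \<gamma>")
        case True
        have "{rgt w<..<rgt w + 2 * \<delta> q} \<inter> E = {}" using gap a(4) True by fastforce
        then show ?thesis using z by (simp add: M_null)
      next
        case False
        have "M {rgt w<..<rgt w + 2 * \<delta> q} \<le> M (I v) + M {rgt v<..<rgt v + \<delta> q}"
        proof (rule M_subadditive)
          show "{rgt w<..<rgt w + 2 * \<delta> q} \<inter> E \<subseteq> I v \<union> {rgt v<..<rgt v + \<delta> q}"
            using gap a(4,5) rgt_v by (fastforce simp: mem_I)
        qed (auto simp: I_borel)
        then show ?thesis
          using right_reach[OF a(2) d0 order_refl] adjacent_mass[OF 2] False two[of "mass v"]
          by (fastforce simp: mass_eq_M)
      qed
    qed
  qed
qed

lemma single_cover: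
  assumes w: "w \<in> words n q" and l: "1 \<le> l" "a + l \<le> n (Suc q)"
    and T: "\<And>z. z \<in> T \<Longrightarrow> z < n (Suc q) \<and> a \<le> z + 4 * l \<and> z < a + 5 * l"
  shows "(\<Sum>z\<in>T. mass (w @ [Suc z])) \<le> 10 * C ^ 4 * (\<Sum>z=a..<a+l. mass (w @ [Suc z]))"
proof -
  have len: "length w = q" using w words_length by auto
  have sum: "(\<Sum>z\<in>U. mass (w @ [Suc z])) = mass w * (\<Sum>z\<in>U. ratios w ! z)" if "U \<subseteq> {..<n (Suc q)}" for U
    unfolding sum_distrib_left
    using that mass_pos[OF w] by (intro sum.cong) (auto simp: nth_ratios len)
  have "(\<Sum>z\<in>T. ratios w ! z) \<le> real (2 * Suc 4) * C ^ 4 * (\<Sum>z=a..<a+l. ratios w ! z)"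
    using T l by (intro uniform_from_cover[OF single_uniform[OF w]]) (auto simp: len)
  then have "mass w * (\<Sum>z\<in>T. ratios w ! z) \<le> mass w * (10 * C ^ 4 * (\<Sum>z=a..<a+l. ratios w ! z))"
    using mass_nonneg by (intro mult_left_mono) auto
  moreover have "T \<subseteq> {..<n (Suc q)}" "{a..<a+l} \<subseteq> {..<n (Suc q)}" using T l by auto
  ultimately show ?thesis using sum[of T] sum[of "{a..<a+l}"] by (simp add: algebra_simps)
qed

text \<open>
  The cells of two neighbours near a window in one of them are controlled by this window.  The window may be
  shorter than the block length for which the concatenated vector is uniform, but by a factor of at most
  four, since the gap has at most four times its length; it is first lengthened inside its own parent,
  where windows of all lengths are controlled.
\<close>

lemma pair_cover:
  assumes adj: "adjacent v v' \<gamma> q" and \<gamma>: "\<gamma> < \<delta> q" "\<gamma> \<le> 4 * (real l * \<sigma> (Suc q))"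
    and u: "h = 0 \<and> u = v \<or> h = n (Suc q) \<and> u = v'"
    and l: "1 \<le> l" "a + l \<le> n (Suc q)"
    and T: "\<And>z. z \<in> T \<Longrightarrow> z < 2 * n (Suc q) \<and> h + a \<le> z + 5 * l \<and> z < h + a + 6 * l"
  shows "(\<Sum>z\<in>T. mass (cell v v' z)) \<le> 120 * C ^ 12 * (\<Sum>z=a..<a+l. mass (u @ [Suc z]))"
proof -
  let ?N = "n (Suc q)" and ?s = "\<sigma> (Suc q)"
  let ?Q = "ratios v @ ratios v'"
  note p = adjacent_props[OF adj]
  have len: "length v = q" "length v' = q" using p words_length by auto
  have lenQ: "length ?Q = 2 * ?N" by (simp add: len)
  have uw: "u \<in> words n q" and lenu: "length u = q" using u p len by auto
  have C0: "0 < C" using C_ge_1 by simp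
  have s0: "0 < ?s" "\<epsilon> (Suc q) < ?s" using \<sigma>_bounds by auto
  obtain S where S: "1 \<le> S" "S \<le> ?N" "uniform_from C S ?Q" "real S * ?s \<le> max ?s (\<gamma> + \<epsilon> (Suc q))"
    by (rule pair_uniform[OF adj \<gamma>(1)])
  have "real S * ?s < (4 * real l + 1) * ?s"
  proof -
    have "0 < real l * ?s" using l s0 by simp
    moreover have "(4 * real l + 1) * ?s = 4 * (real l * ?s) + ?s" by (simp add: algebra_simps)
    ultimately show ?thesis using S(4) \<gamma>(2) s0 by linarith
  qed
  then have "real S < 4 * real l + 1" using s0(1) by (simp only: mult_less_cancel_right_pos)
  then have S4: "S \<le> 4 * l" by linarith
  \<comment> \<open>lengthen the window inside its own half until the concatenated vector controls it\<close>
  define l' where "l' = max l S"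
  define a' where "a' = min a (?N - l')"
  have l': "l \<le> l'" "S \<le> l'" "1 \<le> l'" "l' \<le> ?N" "l' \<le> 4 * l" using S S4 l by (auto simp: l'_def)
  have a': "a' \<le> a" "a + l \<le> a' + l'" "a' + l' \<le> ?N" using l l' by (auto simp: a'_def min_def)
  have mass_v: "mass v \<le> C ^ 3 * mass v'" "mass v' \<le> C ^ 3 * mass v"
    using adjacent_mass[OF adj] \<gamma>(1) \<delta>_pos[of q] by auto
  have self: "mass x \<le> C ^ 3 * mass x" for x using C_power_mono[of 0 3 "mass x"] mass_nonneg by simp
  \<comment> \<open>\<open>\<beta>\<close> replaces both denominators of the ratios, at the cost of the factor \<open>C\<^sup>3\<close>\<close>
  define \<beta> where "\<beta> = C ^ 3 * mass u"
  have \<beta>: "0 \<le> \<beta>" "mass v \<le> \<beta>" "mass v' \<le> \<beta>"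
    using u mass_v self mass_nonneg C0 by (auto simp: \<beta>_def)
  have Qnn: "0 \<le> ?Q ! z" if "z < 2 * ?N" for z
    using that nth_ratios_append[OF p(1,2) that] mass_nonneg by simp
  have "(\<Sum>z\<in>T. mass (cell v v' z)) \<le> (\<Sum>z\<in>T. \<beta> * ?Q ! z)"
  proof (rule sum_mono)
    fix z assume "z \<in> T"
    then have z: "z < 2 * ?N" using T by blast
    have "mass (cell v v' z) = (if z < ?N then mass v else mass v') * ?Q ! z"
      using nth_ratios_append[OF p(1,2) z] mass_pos[OF p(1)] mass_pos[OF p(2)] by auto
    also have "\<dots> \<le> \<beta> * ?Q ! z" using \<beta> Qnn[OF z] by (intro mult_right_mono) auto
    finally show "mass (cell v v' z) \<le> \<beta> * ?Q ! z" .
  qed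
  also have "\<dots> = \<beta> * (\<Sum>z\<in>T. ?Q ! z)" by (simp add: sum_distrib_left)
  also have "(\<Sum>z\<in>T. ?Q ! z) \<le> real (2 * Suc 5) * C ^ 5 * (\<Sum>z=h+a'..<h+a'+l'. ?Q ! z)"
  proof (rule uniform_from_cover[OF S(3) l'(2)])
    show "h + a' + l' \<le> length ?Q" unfolding lenQ using u a' by auto
    fix z assume z: "z \<in> T"
    have "h + a \<le> z + 5 * l" "z < h + a + 6 * l" using T[OF z] by auto
    then show "z < length ?Q \<and> h + a' \<le> z + 5 * l' \<and> z < h + a' + Suc 5 * l'"
      using T[OF z] a' l' unfolding lenQ by simp
  qed
  also have "(\<Sum>z=h+a'..<h+a'+l'. ?Q ! z) = (\<Sum>z=a'..<a'+l'. ?Q ! (h + z))"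
    using sum.shift_bounds_nat_ivl[of "(!) ?Q" a' h "a' + l'"] by (simp add: add.commute add.left_commute)
  also have "\<dots> = (\<Sum>z=a'..<a'+l'. mass (u @ [Suc z]) / mass u)"
  proof (rule sum.cong)
    fix z assume "z \<in> {a'..<a'+l'}"
    then have z: "z < ?N" using a' by simp
    have "h + z < 2 * ?N" using u z by auto
    from nth_ratios_append[OF p(1,2) this] show "?Q ! (h + z) = mass (u @ [Suc z]) / mass u"
      using u z cell_simps[OF len(1)] by auto
  qed simp
  also have "\<dots> = (\<Sum>z=a'..<a'+l'. mass (u @ [Suc z])) / mass u" by (simp add: sum_divide_distrib)
  finally have "(\<Sum>z\<in>T. mass (cell v v' z)) \<le>
      \<beta> * (real (2 * Suc 5) * C ^ 5 * ((\<Sum>z=a'..<a'+l'. mass (u @ [Suc z])) / mass u))"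
    using \<beta>(1) by (simp add: mult_left_mono)
  also have "\<dots> = 12 * C ^ 8 * (\<Sum>z=a'..<a'+l'. mass (u @ [Suc z]))"
    using mass_pos[OF uw] by (simp add: \<beta>_def power_add[symmetric] mult.assoc[symmetric])
  also have "\<dots> \<le> 12 * C ^ 8 * (10 * C ^ 4 * (\<Sum>z=a..<a+l. mass (u @ [Suc z])))"
    using l l' a' C0 by (intro mult_left_mono single_cover[OF uw]) auto
  also have "\<dots> = 120 * C ^ 12 * (\<Sum>z=a..<a+l. mass (u @ [Suc z]))"
    by (simp add: power_add[symmetric] mult.assoc[symmetric])
  finally show ?thesis .
qed

lemma index_bound:
  assumes "(real i - 2) * s < 4 * (real l * s)" "1 \<le> l" "0 < s"
  shows "i \<le> 5 * l"
proof -
  have "(real i - 2) * s < (4 * real l) * s" using assms(1) by (simp add: algebra_simps)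
  then have "real i - 2 < 4 * real l" using assms(3) by (simp only: mult_less_cancel_right_pos)
  then show ?thesis using assms(2) by linarith
qed

text \<open>
  Doubling at scale \<open>\<delta> (Suc q) < r \<le> \<delta> q\<close> is measured by the mass \<open>W\<close> of a run of children in the ball.  If \<open>2 r\<close>
  exceeds \<open>\<delta> q\<close>, the run has a fixed share of the mass of its parent, and the doubled ball meets boundedly
  many comparable components of level \<open>q\<close>.  Otherwise the doubled ball stays inside the parent and its two
  neighbours, and the cells that it meets are within boundedly many run lengths of the run.
\<close>

lemma ball_estimate:
  assumes x: "x \<in> E" and r: "0 < r" "r \<le> 1"
  shows "0 < M (ball x r)" "M (ball x (2 * r)) \<le> 250 * C ^ 12 * M (ball x r)"
proof -
  obtain q where q: "\<delta> (Suc q) < r" "r \<le> \<delta> q" by (rule level_of_scale[OF r])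
  obtain w where w: "w \<in> words n q" "x \<in> I w" by (rule E_word[OF x])
  obtain z0 where z0: "z0 < n (Suc q)" "x \<in> I (w @ [Suc z0])" by (rule E_child[OF x w])
  obtain a l where l: "1 \<le> l" "a + l \<le> n (Suc q)" "a \<le> z0" "z0 < a + l"
    "r \<le> 2 * (real l * \<sigma> (Suc q))" and inball: "\<And>z. z \<in> {a..<a+l} \<Longrightarrow> I (w @ [Suc z]) \<subseteq> ball x r"
    by (rule children_in_ball[OF w(1) z0 q]) blast
  let ?s = "\<sigma> (Suc q)" and ?n = "n (Suc q)"
  have len: "length w = q" using w words_length by auto
  have s0: "0 < ?s" "\<delta> (Suc q) < ?s" "\<epsilon> (Suc q) < ?s" using \<sigma>_bounds by auto
  have C0: "0 < C" using C_ge_1 by simp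
  define W where "W = (\<Sum>z=a..<a+l. mass (w @ [Suc z]))"
  have W0: "0 < W" unfolding W_def
    using l by (intro sum_pos mass_pos[OF words_child[OF w(1)]]) auto
  have W: "W \<le> M (ball x r)" unfolding W_def
    using inball l by (intro sum_mass_le_M[where k = "Suc q"] words_child[OF w(1)]) (auto simp: inj_on_def)
  show "0 < M (ball x r)" using W0 W by linarith
  have Cp: "C ^ i * W \<le> C ^ 12 * W" if "i \<le> 12" for i using that W0 by (intro C_power_mono) auto
  have "M (ball x (2 * r)) \<le> 250 * C ^ 12 * W"
  proof (cases "2 * r \<le> \<delta> q")
    case False
    \<comment> \<open>the run contains a fixed proportion of the children of \<open>w\<close>, hence of its mass\<close>
    have "(real ?n - 1) * ?s < (4 * real l) * ?s"
      using False l(5) \<delta>_split[of q] s0 by (simp add: algebra_simps)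
    then have "real ?n - 1 < 4 * real l" using s0(1) by (simp only: mult_less_cancel_right_pos)
    then have n4: "?n \<le> 4 * l" by linarith
    have "mass w \<le> 10 * C ^ 4 * W" unfolding W_def mass_split[OF w(1)]
      using l n4 by (intro single_cover[OF w(1)]) auto
    moreover have "M (ball x (2 * r)) \<le> mass w + 2 * C ^ 6 * mass w + 2 * C ^ 6 * mass w"
    proof -
      let ?L = "{lft w - 2 * \<delta> q<..<lft w}" and ?R = "{rgt w<..<rgt w + 2 * \<delta> q}"
      have "M (ball x (2 * r)) \<le> M (I w \<union> ?L) + M ?R"
        using w(2) q(2)
        by (intro M_subadditive) (auto simp: I_borel mem_I ball_eq_greaterThanLessThan)
      moreover have "M (I w \<union> ?L) \<le> M (I w) + M ?L"
        by (intro M_subadditive) (auto simp: I_borel)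
      ultimately show ?thesis using far_reach[OF w(1)] by (simp add: mass_eq_M)
    qed
    moreover have "mass w \<le> C ^ 6 * mass w" using C_power_mono[of 0 6 "mass w"] mass_nonneg by simp
    ultimately have "M (ball x (2 * r)) \<le> 5 * C ^ 6 * mass w" by linarith
    also have "\<dots> \<le> 5 * C ^ 6 * (10 * C ^ 4 * W)"
      using \<open>mass w \<le> 10 * C ^ 4 * W\<close> C0 by (intro mult_left_mono) auto
    also have "\<dots> = 50 * (C ^ 10 * W)"
    proof -
      have "C ^ 10 = C ^ 6 * C ^ 4" by (simp flip: power_add)
      then show ?thesis by simp
    qed
    finally have "M (ball x (2 * r)) \<le> 50 * (C ^ 10 * W)" .
    moreover have "C ^ 10 * W \<le> C ^ 12 * W" by (rule Cp) simp
    moreover have "0 < C ^ 12 * W" using C0 W0 by simp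
    ultimately show ?thesis unfolding mult.assoc by linarith
  next
    case True
    \<comment> \<open>a neighbour is reached only across a gap shorter than \<open>\<delta> q\<close>, where \<open>pair_cover\<close> applies\<close>
    let ?B = "ball x (2 * r)"
    have B: "y \<in> ?B \<longleftrightarrow> x - 2 * r < y \<and> y < x + 2 * r" for y
      by (simp add: ball_eq_greaterThanLessThan)
    have rl: "2 * r \<le> 4 * (real l * ?s)" using l(5) by simp
    have inside: "M (?B \<inter> I w) \<le> 10 * C ^ 4 * W"
    proof -
      define T where "T = {z. z < ?n \<and> I (w @ [Suc z]) \<inter> ?B \<noteq> {}}"
      have "M (?B \<inter> I w) \<le> (\<Sum>z\<in>T. mass (w @ [Suc z]))"
      proof (rule M_le_sum_mass)
        show "?B \<inter> I w \<inter> E \<subseteq> (\<Union>z\<in>T. I (w @ [Suc z]))"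
        proof
          fix y assume y: "y \<in> ?B \<inter> I w \<inter> E"
          then obtain z where "z < ?n" "y \<in> I (w @ [Suc z])" using E_child[OF _ w(1)] by blast
          moreover from this have "z \<in> T" unfolding T_def using y by blast
          ultimately show "y \<in> (\<Union>z\<in>T. I (w @ [Suc z]))" by blast
        qed
      qed (auto simp: T_def I_borel)
      also have "\<dots> \<le> 10 * C ^ 4 * W" unfolding W_def
      proof (rule single_cover[OF w(1) l(1,2)])
        fix z assume "z \<in> T"
        then obtain y where z: "z < ?n" and y: "y \<in> I (w @ [Suc z])" "y \<in> ?B" by (auto simp: T_def)
        have "\<bar>real z - real z0\<bar> < 4 * real l + 1"
        proof -
          have "lft w + real z * ?s \<le> y" "y \<le> lft w + real z * ?s + \<delta> (Suc q)"
            "lft w + real z0 * ?s \<le> x" "x \<le> lft w + real z0 * ?s + \<delta> (Suc q)"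
            using y(1) z0(2) by (auto simp: mem_I lft_child rgt_child len)
          moreover have "x - 2 * r < y" "y < x + 2 * r" using y(2) B by auto
          ultimately have "real z * ?s - real z0 * ?s < 4 * (real l * ?s) + ?s"
            "real z0 * ?s - real z * ?s < 4 * (real l * ?s) + ?s" using rl s0 by linarith+
          then have "(real z - real z0) * ?s < (4 * real l + 1) * ?s"
            "(real z0 - real z) * ?s < (4 * real l + 1) * ?s" by (simp_all add: algebra_simps)
          then have "real z - real z0 < 4 * real l + 1" "real z0 - real z < 4 * real l + 1"
            using s0(1) by (simp_all only: mult_less_cancel_right_pos)
          then show ?thesis by linarith
        qed
        then have "z \<le> z0 + 4 * l" "z0 \<le> z + 4 * l" by linarith+
        then show "z < ?n \<and> a \<le> z + 4 * l \<and> z < a + 5 * l" using z l by linarith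
      qed
      finally show ?thesis .
    qed
    have left: "M (?B \<inter> {..<lft w}) \<le> 120 * C ^ 12 * W"
    proof -
      have null: ?thesis if "?B \<inter> {..<lft w} \<inter> E = {}"
        using M_null[OF that] C0 W0 by simp
      consider "lft w = 0" | v \<gamma> where "adjacent v w \<gamma> q" using left_neighbour[OF w(1)] by blast
      then show ?thesis
      proof cases
        case 1
        then show ?thesis using E_bounds by (intro null) fastforce
      next
        case (2 v \<gamma>)
        note p = adjacent_props[OF 2] and gap = adjacent_gap_empty[OF 2]
        have rgt_v: "rgt v = lft v + \<delta> q" "length v = q" using words_length[OF p(1)] by (auto simp: rgt_def)
        show ?thesis
        proof (cases "2 * r \<le> \<gamma>")
          case True
          have False if "y \<in> ?B \<inter> {..<lft w} \<inter> E" for y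
          proof -
            have "x - 2 * r < y" "y < lft w" "y \<in> E" using that B by auto
            then show False using gap[of y] p(4) True w(2) unfolding mem_I by linarith
          qed
          then have "?B \<inter> {..<lft w} \<inter> E = {}" by blast
          then show ?thesis by (rule null)
        next
          case False
          have \<gamma>: "\<gamma> < \<delta> q" "\<gamma> \<le> 4 * (real l * ?s)" using False True rl by auto
          define T where "T = {z. z < ?n \<and> I (v @ [Suc z]) \<inter> ?B \<noteq> {}}"
          have cell: "cell v w z = v @ [Suc z]" if "z \<in> T" for z
            using that cell_simps(1)[OF rgt_v(2)] by (simp add: T_def)
          have "M (?B \<inter> {..<lft w}) \<le> (\<Sum>z\<in>T. mass (cell v w z))"
          proof (rule M_le_sum_mass)
            show "?B \<inter> {..<lft w} \<inter> E \<subseteq> (\<Union>z\<in>T. I (cell v w z))"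
            proof
              fix y assume y: "y \<in> ?B \<inter> {..<lft w} \<inter> E"
              have yB: "x - 2 * r < y" "y < lft w" using y B by auto
              have "y \<le> rgt v" using y gap[of y] yB by auto
              moreover have "lft v \<le> y"
                using yB w(2) \<open>2 * r \<le> \<delta> q\<close> p(4,5) rgt_v(1) unfolding mem_I by linarith
              ultimately have "y \<in> I v" by (simp add: mem_I)
              then obtain z where "z < ?n" "y \<in> I (v @ [Suc z])" using y E_child[OF _ p(1)] by blast
              then have "z \<in> T" unfolding T_def using y by blast
              then show "y \<in> (\<Union>z\<in>T. I (cell v w z))" using cell \<open>y \<in> I (v @ [Suc z])\<close> by auto
            qed
          qed (auto simp: T_def)
          also have "\<dots> \<le> 120 * C ^ 12 * W" unfolding W_def
          proof (rule pair_cover[OF 2 \<gamma> _ l(1,2), where h = ?n])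
            fix z assume zT: "z \<in> T"
            then obtain y where z: "z < ?n" and y: "y \<in> I (v @ [Suc z])" "y \<in> ?B" by (auto simp: T_def)
            have xz: "x \<in> I (cell v w (?n + z0))" using z0 cell_simps(2)[OF rgt_v(2)] by simp
            have "(real (?n + z0) - real z - 2) * ?s \<le> x - y"
              by (rule cell_distance(1)[OF p(1,2,4) _ _ _ _ _ xz]) (use z z0 p(5) y cell[OF zT] in auto)
            also have "\<dots> < 4 * (real l * ?s)" using y(2) B rl by fastforce
            finally have "(real (?n + z0 - z) - 2) * ?s < 4 * (real l * ?s)" using z by (simp add: of_nat_diff)
            then have "?n + z0 - z \<le> 5 * l" using l(1) s0(1) by (rule index_bound)
            then show "z < 2 * ?n \<and> ?n + a \<le> z + 5 * l \<and> z < ?n + a + 6 * l" using z l by linarith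
          qed simp
          finally show ?thesis .
        qed
      qed
    qed
    have right: "M (?B \<inter> {rgt w<..}) \<le> 120 * C ^ 12 * W"
    proof -
      have null: ?thesis if "?B \<inter> {rgt w<..} \<inter> E = {}"
        using M_null[OF that] C0 W0 by simp
      consider "rgt w = 1" | v \<gamma> where "adjacent w v \<gamma> q" using right_neighbour[OF w(1)] by blast
      then show ?thesis
      proof cases
        case 1
        then show ?thesis using E_bounds by (intro null) fastforce
      next
        case (2 v \<gamma>)
        note p = adjacent_props[OF 2] and gap = adjacent_gap_empty[OF 2]
        have rgt_v: "rgt v = lft v + \<delta> q" "length v = q" using words_length[OF p(2)] by (auto simp: rgt_def)
        show ?thesis
        proof (cases "2 * r \<le> \<gamma>")
          case True
          have False if "y \<in> ?B \<inter> {rgt w<..} \<inter> E" for y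
          proof -
            have "y < x + 2 * r" "rgt w < y" "y \<in> E" using that B by auto
            then show False using gap[of y] p(4) True w(2) unfolding mem_I by linarith
          qed
          then have "?B \<inter> {rgt w<..} \<inter> E = {}" by blast
          then show ?thesis by (rule null)
        next
          case False
          have \<gamma>: "\<gamma> < \<delta> q" "\<gamma> \<le> 4 * (real l * ?s)" using False True rl by auto
          define T where "T = {z. ?n \<le> z \<and> z < 2 * ?n \<and> I (cell w v z) \<inter> ?B \<noteq> {}}"
          have "T \<subseteq> {..<2 * ?n}" by (auto simp: T_def)
          then have finT: "finite T" by (rule finite_subset) simp
          have "M (?B \<inter> {rgt w<..}) \<le> (\<Sum>z\<in>T. mass (cell w v z))"
          proof (rule M_le_sum_mass[OF finT])
            show "?B \<inter> {rgt w<..} \<inter> E \<subseteq> (\<Union>z\<in>T. I (cell w v z))"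
            proof
              fix y assume y: "y \<in> ?B \<inter> {rgt w<..} \<inter> E"
              have yB: "y < x + 2 * r" "rgt w < y" using y B by auto
              have "lft v \<le> y" using y gap[of y] yB by auto
              moreover have "y \<le> rgt v"
                using yB w(2) \<open>2 * r \<le> \<delta> q\<close> p(4,5) rgt_v(1) unfolding mem_I by linarith
              ultimately have "y \<in> I v" by (simp add: mem_I)
              then obtain z where z: "z < ?n" "y \<in> I (v @ [Suc z])" using y E_child[OF _ p(2)] by blast
              then have "y \<in> I (cell w v (?n + z))" using cell_simps(2)[OF len] by simp
              moreover from this have "?n + z \<in> T" unfolding T_def using y z by auto
              ultimately show "y \<in> (\<Union>z\<in>T. I (cell w v z))" by blast
            qed
          qed auto
          also have "\<dots> \<le> 120 * C ^ 12 * W" unfolding W_def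
          proof (rule pair_cover[OF 2 \<gamma> _ l(1,2), where h = 0])
            fix z assume "z \<in> T"
            then obtain y where z: "?n \<le> z" "z < 2 * ?n" and y: "y \<in> I (cell w v z)" "y \<in> ?B"
              by (auto simp: T_def)
            have xz: "x \<in> I (cell w v z0)" using z0 cell_simps(1)[OF len] by simp
            have "(real z - real z0 - 2) * ?s \<le> y - x"
              by (rule cell_distance(1)[OF p(1,2,4) _ _ _ _ xz y(1)]) (use z z0 p(5) in auto)
            also have "\<dots> < 4 * (real l * ?s)" using y(2) B rl by fastforce
            finally have "(real (z - z0) - 2) * ?s < 4 * (real l * ?s)" using z z0 by (simp add: of_nat_diff)
            then have "z - z0 \<le> 5 * l" using l(1) s0(1) by (rule index_bound)
            then show "z < 2 * ?n \<and> 0 + a \<le> z + 5 * l \<and> z < 0 + a + 6 * l" using z z0 l by linarith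
          qed simp
          finally show ?thesis .
        qed
      qed
    qed
    have bor: "?B \<in> sets borel" "?B \<inter> I w \<in> sets borel" "?B \<inter> {..<lft w} \<in> sets borel"
      "?B \<inter> {rgt w<..} \<in> sets borel"
      using I_borel[of w] by (simp_all add: sets.Int)
    have "M ?B \<le> M (?B \<inter> I w \<union> ?B \<inter> {..<lft w}) + M (?B \<inter> {rgt w<..})"
      by (rule M_subadditive[OF bor(1) sets.Un[OF bor(2,3)] bor(4)]) (auto simp: I_eq)
    moreover have "M (?B \<inter> I w \<union> ?B \<inter> {..<lft w}) \<le> M (?B \<inter> I w) + M (?B \<inter> {..<lft w})"
      by (rule M_subadditive[OF sets.Un[OF bor(2,3)] bor(2,3)]) auto
    ultimately have "M ?B \<le> 10 * (C ^ 4 * W) + 120 * (C ^ 12 * W) + 120 * (C ^ 12 * W)"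
      using inside left right unfolding mult.assoc by linarith
    moreover have "C ^ 4 * W \<le> C ^ 12 * W" by (rule Cp) simp
    ultimately show ?thesis unfolding mult.assoc by linarith
  qed
  also have "\<dots> \<le> 250 * C ^ 12 * M (ball x r)" using W C0 by (intro mult_left_mono) auto
  finally show "M (ball x (2 * r)) \<le> 250 * C ^ 12 * M (ball x r)" .
qed

lemma adapted_imp_doubling: "doubling_measure_on E \<mu>"
  unfolding doubling_iff
proof (intro exI[of _ "250 * C ^ 12"] conjI ballI allI impI)
  show "1 \<le> 250 * C ^ 12" using one_le_power[OF C_ge_1, of 12] by linarith
  fix x r :: real assume x: "x \<in> E" and r: "0 < r"
  have large: "M (ball x s) = 1" if "1 < s" for s
  proof -
    have "M UNIV \<le> M (ball x s)"
    proof (rule M_mono)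
      show "UNIV \<inter> E \<subseteq> ball x s"
      proof
        fix y assume "y \<in> UNIV \<inter> E"
        then show "y \<in> ball x s"
          using E_bounds[OF x] E_bounds[of y] that by (simp add: ball_eq_greaterThanLessThan)
      qed
    qed auto
    moreover have "M (ball x s) \<le> M UNIV" by (intro M_mono) auto
    ultimately show ?thesis by (simp add: M_UNIV)
  qed
  show "0 < M (ball x (2 * r))" using ball_estimate(1)[OF x, of "2 * r"] large[of "2 * r"] r by linarith
  show "M (ball x (2 * r)) \<le> 250 * C ^ 12 * M (ball x r)"
  proof (cases "r \<le> 1")
    case False
    then show ?thesis using large \<open>1 \<le> 250 * C ^ 12\<close> by simp
  qed (rule ball_estimate(2)[OF x r])
qed

end

section \<open>The criterion\<close>

context cantor_measure begin

lemma doubling_iff_adapted: "doubling_measure_on E \<mu> \<longleftrightarrow> (\<exists>C>1. adapted C)"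
proof
  assume "doubling_measure_on E \<mu>"
  then obtain D where D: "1 \<le> D" "\<And>x r. x \<in> E \<Longrightarrow> 0 < r \<Longrightarrow> M (ball x (2 * r)) \<le> D * M (ball x r)"
    unfolding doubling_iff by blast
  interpret doubling_cantor_measure n c \<mu> D by unfold_locales (use D in auto)
  have "1 < D ^ 51 + 1" using D(1) by simp
  then show "\<exists>C>1. adapted C" using doubling_imp_adapted by blast
next
  assume "\<exists>C>1. adapted C"
  then obtain C where C: "1 < C" "adapted C" by blast
  have root: "[] \<in> words n 0" by (simp add: words_0[OF params])
  have "\<exists>C0. uniform_vec C0 (ratios [])"
  proof (rule uniform_vec_exists)
    have "length (ratios []) \<noteq> 0" using n_ge_2[of 1] by simp
    then show "ratios [] \<noteq> []" by (metis list.size(3))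
    fix z assume "z < length (ratios [])"
    then have z: "z < n (Suc 0)" by simp
    then show "0 < ratios [] ! z"
      using mass_pos[OF root] mass_pos[OF words_child[OF root z]] nth_ratios[of z "[]"] by simp
  qed
  then obtain C0 where C0: "uniform_vec C0 (ratios [])" by blast
  let ?C = "max C C0"
  interpret adapted_cantor_measure n c \<mu> ?C
  proof unfold_locales
    show "1 \<le> ?C" using C by simp
    show "adapted ?C" by (rule adapted_mono[OF C(2)]) (use C(1) in auto)
    show "uniform_vec ?C (ratios [])" using C0 by (rule uniform_from_mono) simp
  qed
  show "doubling_measure_on E \<mu>" by (rule adapted_imp_doubling)
qed

end

theorem theorem2:
  fixes n :: "nat \<Rightarrow> nat" and c :: "nat \<Rightarrow> real" and \<mu> :: "real measure"
  assumes "cantor_params n c"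
    and "prob_space \<mu>"
    and "borel_measure_on (cantor_set n c) \<mu>"
    and "\<forall>w\<in>all_words n. word_mass n c \<mu> w > 0"
  shows "doubling_measure_on (cantor_set n c) \<mu> \<longleftrightarrow>
    (\<exists>C>1.
      (\<forall>w\<in>all_words n. uniform_vec C (ratio_vec n c \<mu> w)) \<and>
      (\<forall>k\<in>large_gap_levels n c.
        (\<forall>w\<in>words n (k - 1). \<forall>i t.
          1 \<le> i \<and> i < n k \<and> 1 \<le> t \<and> t < depth_idx n c k \<longrightarrow>
            uniform_vec C
              (ratio_vec n c \<mu> (max_word_ext n (w @ [i]) (t - 1)) @
               ratio_vec n c \<mu> (min_word_ext (w @ [i + 1]) (t - 1))) \<and>
            inverse C * (\<Prod>j=1..t. word_ratio n c \<mu> (max_word_ext n (w @ [i]) j))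
              \<le> (\<Prod>j=1..t. word_ratio n c \<mu> (min_word_ext (w @ [i + 1]) j)) \<and>
            (\<Prod>j=1..t. word_ratio n c \<mu> (min_word_ext (w @ [i + 1]) j))
              \<le> C * (\<Prod>j=1..t. word_ratio n c \<mu> (max_word_ext n (w @ [i]) j))) \<and>
        (\<forall>w\<in>words n (k - 1). \<forall>i.
          1 \<le> i \<and> i < n k \<longrightarrow>
            uniform_from C (block_idx n c k)
              (ratio_vec n c \<mu> (max_word_ext n (w @ [i]) (depth_idx n c k - 1)) @
               ratio_vec n c \<mu> (min_word_ext (w @ [i + 1]) (depth_idx n c k - 1))))))"
proof -
  interpret prob_space \<mu> by fact
  interpret cantor_measure n c \<mu> by unfold_locales (use assms in auto)
  show ?thesis using doubling_iff_adapted unfolding adapted_def .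
qed

end
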